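(* Let $u$ be a harmonic function in the open upper half-plane $\mathbb{H}$ which is of temperate growth at infinity. Assume that (1)' $\lim_{y\to0+}u(\cdot+iy)=0$ in $\mathcal{D}'(\mathbb{R})$; and (2) there are $x_1,x_2\in\mathbb{R}$ with $x_1\neq x_2$ such that $\displaystyle\lim_{y\to+\infty}u(x+iy)/y=0$ for $x=x_1$ and for $x=x_2$. Then $u(z)=0$ for all $z\in\mathbb{H}$.
   Context: $\mathbb{H}=\{z\in\mathbb{C}:\operatorname{Im} z>0\}$ is the open upper half-plane. Harmonic functions are complex-valued $C^2$ functions annihilated by the usual Laplacian. A function $u$ in $\mathbb{H}$ is of temperate growth at infinity if there are positive constants $C,R,N$ such that $|u(z)|\leq C\,(|z|^2/\operatorname{Im} z)^N$ for all $z\in\mathbb{H}$ with $|z|>R$. $\lim_{y\to0+}u(\cdot+iy)=0$ in $\mathcal{D}'(\mathbb{R})$ means that $\lim_{y\to0+}\int_{-\infty}^\infty u(x+iy)\psi(x)\,dx=0$ for every $\psi\in C_0^\infty(\mathbb{R})$ (smooth compactly supported test functions). *)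

theory Defs
  imports "HOL-Analysis.Analysis"
begin

definition upper_halfplane :: "complex set" where
  "upper_halfplane = {z. 0 < Im z}"

text \<open>For \<open>v \<in> Basis\<close> this is a partial derivative; on \<^typ>\<open>complex\<close>, viewed as the real plane,
  \<open>Basis = {1, \<i>}\<close>, so the two cases are the partial derivatives in \<open>x\<close> and in \<open>y\<close>. On
  \<^typ>\<open>real\<close>, \<open>Basis = {1}\<close> and one gets the ordinary derivative.\<close>

definition dir_deriv ::
  "'a::euclidean_space \<Rightarrow> ('a \<Rightarrow> 'b::real_normed_vector) \<Rightarrow> 'a \<Rightarrow> 'b" where
  "dir_deriv v f z = vector_derivative (\<lambda>t::real. f (z + t *\<^sub>R v)) (at 0)"

text \<open>Class \<open>C\<^sup>k\<close>: all partial derivatives up to order \<open>k\<close> exist and are continuous. Meant for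
  open \<open>S\<close> only, since the partial derivatives are two-sided.\<close>

primrec Ck_on ::
  "nat \<Rightarrow> 'a::euclidean_space set \<Rightarrow> ('a \<Rightarrow> 'b::real_normed_vector) \<Rightarrow> bool" where
  "Ck_on 0 S f \<longleftrightarrow> continuous_on S f"
| "Ck_on (Suc k) S f \<longleftrightarrow>
     continuous_on S f \<and>
     (\<forall>v\<in>Basis. (\<forall>z\<in>S. (\<lambda>t::real. f (z + t *\<^sub>R v)) differentiable (at 0))
                \<and> Ck_on k S (dir_deriv v f))"

definition laplacian ::
  "('a::euclidean_space \<Rightarrow> 'b::real_normed_vector) \<Rightarrow> 'a \<Rightarrow> 'b" where
  "laplacian f z = (\<Sum>v\<in>Basis. dir_deriv v (dir_deriv v f) z)"

definition harmonic_on ::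
  "'a::euclidean_space set \<Rightarrow> ('a \<Rightarrow> 'b::real_normed_vector) \<Rightarrow> bool" where
  "harmonic_on S f \<longleftrightarrow> open S \<and> Ck_on 2 S f \<and> (\<forall>z\<in>S. laplacian f z = 0)"

definition temperate_at_infinity :: "(complex \<Rightarrow> complex) \<Rightarrow> bool" where
  "temperate_at_infinity u \<longleftrightarrow>
     (\<exists>C>0. \<exists>R>0. \<exists>N>0. \<forall>z\<in>upper_halfplane. norm z > R \<longrightarrow>
        norm (u z) \<le> C * ((norm z)\<^sup>2 / Im z) powr N)"

text \<open>\<open>C\<^sub>0\<^sup>\<infinity>(\<real>)\<close>, complex-valued as usual for distributions.\<close>

definition test_function :: "(real \<Rightarrow> complex) \<Rightarrow> bool" where
  "test_function \<psi> \<longleftrightarrow> (\<forall>k. Ck_on k UNIV \<psi>) \<and> compact (closure {x. \<psi> x \<noteq> 0})"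

definition boundary_limit_zero :: "(complex \<Rightarrow> complex) \<Rightarrow> bool" where
  "boundary_limit_zero u \<longleftrightarrow>
     (\<forall>\<psi>. test_function \<psi> \<longrightarrow>
        ((\<lambda>y::real. LINT x|lborel. u (Complex x y) * \<psi> x) \<longlongrightarrow> 0) (at_right 0))"

end

theory Submission
  imports Defs "HOL-Complex_Analysis.Complex_Analysis"
    "HOL-Computational_Algebra.Fundamental_Theorem_Algebra"
begin

text \<open>
  The real and imaginary parts of \<open>u\<close> are imaginary parts of functions \<open>h\<close> holomorphic in the
  half-plane. Convolving \<open>h\<close> in the real direction with a test function gives \<open>g\<close>; a gliding hump
  argument shows that \<open>Im g\<close> and all its derivatives in the real direction are locally bounded at the
  real line, so that \<open>g\<close> extends continuously with real boundary values and, by Schwarz reflection,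
  to an entire function. The temperate growth of its imaginary part forces this entire function to be a
  polynomial of degree bounded independently of the test function. Hence a fixed derivative of \<open>h\<close> is
  orthogonal to all test functions, \<open>h\<close> is a polynomial \<open>p\<close>, and \<open>p\<close> is real on the real line.
  Each ray condition makes \<open>p\<close> symmetric about \<open>x\<^sub>j\<close>; two symmetries make it periodic, so constant.
\<close>

text \<open>The boundary hypothesis is not pointwise, and its rate of convergence may depend on the
  test function. Smearing turns it into statements about values of holomorphic functions, and the
  gliding hump supplies uniformity under translation. Derivatives of test functions are test
  functions, so integration by parts controls derivatives as well; this compensates for the absence
  of any hypothesis on the conjugate function \<open>Re h\<close>. The exponent survives smearing
  because horizontal translation preserves \<open>Im z\<close>; hence the degree bound is common to
  all test functions, and the smearing can be undone. Every polynomial with real coefficients has an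
  imaginary part obeying growth and boundary condition, so the rays must exclude these. One ray
  cannot: \<open>Im ((z - x1)^2) = 2 * (x - x1) * y\<close> vanishes above
  \<open>x1\<close>.\<close>

subsection \<open>Test functions\<close>

text \<open>A real test function supported in \<open>{-a..a}\<close>, packaged as the sequence of all its derivatives.\<close>

definition smooth_tower :: "(nat \<Rightarrow> real \<Rightarrow> real) \<Rightarrow> real \<Rightarrow> bool" where
  "smooth_tower D a \<longleftrightarrow>
     (\<forall>n x. (D n has_real_derivative D (Suc n) x) (at x)) \<and> (\<forall>n x. a \<le> \<bar>x\<bar> \<longrightarrow> D n x = 0)"

lemma smooth_towerD:
  assumes "smooth_tower D a"
  shows smooth_tower_deriv: "(D n has_real_derivative D (Suc n) x) (at x)"
    and smooth_tower_zero: "a \<le> \<bar>x\<bar> \<Longrightarrow> D n x = 0"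
  using assms by (auto simp: smooth_tower_def)

lemma smooth_tower_continuous: "smooth_tower D a \<Longrightarrow> continuous_on S (D n)"
  by (rule DERIV_continuous_on[where D = "D (Suc n)"])
     (auto intro: has_field_derivative_at_within smooth_tower_deriv)

lemma smooth_tower_shift: "smooth_tower D a \<Longrightarrow> smooth_tower (\<lambda>n. D (n + k)) a"
  by (auto simp: smooth_tower_def)

lemma smooth_tower_bounded:
  assumes "smooth_tower D a"
  obtains K where "0 < K" "\<And>x. \<bar>D n x\<bar> \<le> K"
proof -
  have "compact (D n ` {-a..a})"
    by (intro compact_continuous_image smooth_tower_continuous[OF assms]) auto
  then obtain K where K: "K > 0" "\<And>x. x \<in> {-a..a} \<Longrightarrow> \<bar>D n x\<bar> \<le> K"
    by (metis bounded_pos compact_imp_bounded imageI real_norm_def)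
  have "\<bar>D n x\<bar> \<le> K" for x
    using K smooth_tower_zero[OF assms, of x n] by (cases "x \<in> {-a..a}") (auto simp: not_le)
  with K show ?thesis using that by blast
qed

text \<open>Differentiating moves one step up the tower, so the induction on \<open>k\<close> has to
  run over all entries \<open>D n\<close> at once.\<close>

lemma test_function_smooth_tower:
  assumes "smooth_tower D a"
  shows "test_function (\<lambda>x. complex_of_real (D 0 x))"
proof -
  have der: "((\<lambda>t. complex_of_real (D n (x + t))) has_vector_derivative of_real (D (Suc n) x)) (at 0)"
    for n x
  proof -
    have "((\<lambda>t. D n (x + t)) has_real_derivative D (Suc n) x) (at 0)"
      using smooth_tower_deriv[OF assms, of n x] DERIV_shift[of "D n" _ 0 x] by (simp add: add.commute)
    thus ?thesis
      by (intro has_vector_derivative_of_real) (simp add: has_real_derivative_iff_has_vector_derivative)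
  qed
  have dd: "dir_deriv 1 (\<lambda>x. complex_of_real (D n x)) = (\<lambda>x. complex_of_real (D (Suc n) x))" for n
    using der by (auto simp: dir_deriv_def fun_eq_iff intro!: vector_derivative_at)
  have "Ck_on k UNIV (\<lambda>x. complex_of_real (D n x))" for k n
  proof (induction k arbitrary: n)
    case 0
    show ?case by (auto intro!: continuous_intros smooth_tower_continuous[OF assms])
  next
    case (Suc k)
    have "(\<lambda>t. complex_of_real (D n (z + t *\<^sub>R 1))) differentiable (at 0)" for z
      using der[of n z] by (auto intro: differentiableI_vector)
    with Suc show ?case
      by (auto intro!: continuous_intros smooth_tower_continuous[OF assms] simp: dd)
  qed
  moreover have "closure {x. complex_of_real (D 0 x) \<noteq> 0} \<subseteq> {-a..a}"
    using smooth_tower_zero[OF assms, of _ 0] by (intro closure_minimal) (force simp: abs_le_iff not_le)+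
  ultimately show ?thesis
    unfolding test_function_def
    by (metis bounded_subset bounded_closed_interval closed_closure compact_eq_bounded_closed)
qed

text \<open>With \<open>s = 1 / (1 - t\<^sup>2)\<close> one has \<open>s' = 2 t s\<^sup>2\<close>, so the derivatives of \<open>exp (- s)\<close> have the form
  \<open>p\<^sub>n(t) s ^ (2 * n) exp (- s)\<close>; the recursion for \<open>p\<^sub>n\<close> clears denominators using \<open>s (1 - t\<^sup>2) = 1\<close>.\<close>

primrec bump_poly :: "nat \<Rightarrow> real poly" where
  "bump_poly 0 = 1"
| "bump_poly (Suc n) = pderiv (bump_poly n) * [:1, 0, -1:]^2
     + [:0, 4 * real n:] * [:1, 0, -1:] * bump_poly n - [:0, 2:] * bump_poly n"

definition bump :: "nat \<Rightarrow> real \<Rightarrow> real" where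
  "bump n t = (if \<bar>t\<bar> < 1
     then poly (bump_poly n) t * (1 / (1 - t\<^sup>2)) ^ (2 * n) * exp (- (1 / (1 - t\<^sup>2))) else 0)"

text \<open>The difference quotient at \<open>a\<close> is at most \<open>C * |x - a|\<close>.
  Needed at -1 and 1, where the two branches of \<open>bump\<close> meet and no single formula holds
  on both sides.\<close>

lemma DERIV_zero_if_quadratic_bound:
  fixes f :: "real \<Rightarrow> real"
  assumes "f a = 0" "\<And>x. \<bar>f x\<bar> \<le> C * (x - a)\<^sup>2"
  shows "(f has_real_derivative 0) (at a)"
proof -
  have lim: "((\<lambda>x. C * \<bar>x - a\<bar>) \<longlongrightarrow> 0) (at a)"
    by (auto intro!: tendsto_eq_intros)
  have le: "norm ((f x - f a) / (x - a)) \<le> C * \<bar>x - a\<bar>" if "x \<noteq> a" for x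
  proof -
    have "\<bar>f x\<bar> \<le> C * \<bar>x - a\<bar> * \<bar>x - a\<bar>"
      using assms(2)[of x] by (simp add: power2_eq_square mult.assoc)
    thus ?thesis using that assms(1) by (simp add: divide_le_eq)
  qed
  have "((\<lambda>x. (f x - f a) / (x - a)) \<longlongrightarrow> 0) (at a)"
    by (rule Lim_null_comparison[OF _ lim], unfold eventually_at_filter, intro always_eventually)
       (use le in blast)
  thus ?thesis by (simp only: has_field_derivative_iff)
qed

lemma power_le_fact_exp:
  fixes s :: real assumes "0 \<le> s" shows "s ^ m \<le> fact m * exp s"
proof -
  have "(\<Sum>n\<in>{m}. s ^ n /\<^sub>R fact n) \<le> (\<Sum>n. s ^ n /\<^sub>R fact n)"
    by (rule sum_le_suminf) (use assms summable_exp[of s] in auto)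
  thus ?thesis by (simp add: exp_def field_simps)
qed

text \<open>The exponential beats every power of \<open>s = 1 / (1 - t^2)\<close>.\<close>

lemma bump_bound: "\<exists>K. \<forall>t. \<bar>t\<bar> < 1 \<longrightarrow> \<bar>bump n t\<bar> \<le> K * (1 - t\<^sup>2)\<^sup>2"
proof -
  have "compact (poly (bump_poly n) ` {-1..1})"
    by (intro compact_continuous_image continuous_intros) auto
  then obtain P where P: "P > 0" "\<And>x. x \<in> {-1..1} \<Longrightarrow> \<bar>poly (bump_poly n) x\<bar> \<le> P"
    by (metis bounded_pos compact_imp_bounded imageI real_norm_def)
  have "\<bar>bump n t\<bar> \<le> P * fact (2 * n + 2) * (1 - t\<^sup>2)\<^sup>2" if "\<bar>t\<bar> < 1" for t
  proof -
    define s where "s = 1 / (1 - t\<^sup>2)"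
    have t: "1 - t\<^sup>2 > 0" using that by (simp add: abs_square_less_1)
    hence s: "s > 0" by (simp add: s_def)
    \<comment> \<open>Of the \<open>2 * n + 2\<close> powers, \<open>2 * n\<close> come from
      \<open>bump n\<close>; the other two pay for the factor
      \<open>(1 - t^2)^2 = 1 / s^2\<close>.\<close>
    have "s ^ (2 * n) * exp (- s) * s\<^sup>2 = s ^ (2 * n + 2) * exp (- s)"
      by (simp add: power_add power2_eq_square)
    also have "\<dots> \<le> fact (2 * n + 2) * exp s * exp (- s)"
      using s by (intro mult_right_mono power_le_fact_exp) auto
    also have "\<dots> = fact (2 * n + 2)"
      by (metis exp_minus_inverse mult.assoc mult.right_neutral)
    finally have "s ^ (2 * n) * exp (- s) \<le> fact (2 * n + 2) / s\<^sup>2"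
      using s by (simp add: field_simps)
    hence 1: "s ^ (2 * n) * exp (- s) \<le> fact (2 * n + 2) * (1 - t\<^sup>2)\<^sup>2"
      by (simp add: s_def power_divide)
    have "\<bar>bump n t\<bar> = \<bar>poly (bump_poly n) t\<bar> * (s ^ (2 * n) * exp (- s))"
      using that s by (simp add: bump_def s_def abs_mult)
    also have "\<dots> \<le> P * (fact (2 * n + 2) * (1 - t\<^sup>2)\<^sup>2)"
      using s P(1) by (intro mult_mono P(2) 1) (use that in auto)
    finally show ?thesis by (simp add: mult.assoc)
  qed
  thus ?thesis by blast
qed

lemma DERIV_poly_power_exp:
  fixes S :: "real \<Rightarrow> real"
  assumes "(S has_real_derivative S') (at t)"
  shows "((\<lambda>t. poly q t * S t ^ m * exp (- S t)) has_real_derivative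
     poly (pderiv q) t * S t ^ m * exp (- S t) + poly q t * (m * S t ^ (m - 1) * S') * exp (- S t)
     + poly q t * S t ^ m * (exp (- S t) * - S')) (at t)"
  by (rule derivative_eq_intros assms poly_DERIV refl)+ (simp add: algebra_simps)

lemma bump_deriv: "(bump n has_real_derivative bump (Suc n) t) (at t)"
proof -
  consider "\<bar>t\<bar> < 1" | "\<bar>t\<bar> = 1" | "1 < \<bar>t\<bar>" by linarith
  thus ?thesis
  proof cases
    case 1
    have t: "1 - t\<^sup>2 > 0" using 1 by (simp add: abs_square_less_1)
    define p where "p = poly (bump_poly n) t"
    define p' where "p' = poly (pderiv (bump_poly n)) t"
    define s where "s = 1 / (1 - t\<^sup>2)"
    have s: "s * (1 - t\<^sup>2) = 1" using t by (simp add: s_def)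
    have ds: "((\<lambda>t. 1 / (1 - t\<^sup>2)) has_real_derivative 2 * t * s\<^sup>2) (at t)"
      using t by (auto intro!: derivative_eq_intros simp: s_def field_simps power2_eq_square)
    have "((\<lambda>t. poly (bump_poly n) t * (1 / (1 - t\<^sup>2)) ^ (2 * n) * exp (- (1 / (1 - t\<^sup>2))))
       has_real_derivative
        p' * s ^ (2 * n) * exp (- s) + p * (2 * n * s ^ (2 * n - 1) * (2 * t * s\<^sup>2)) * exp (- s)
        + p * s ^ (2 * n) * (exp (- s) * - (2 * t * s\<^sup>2))) (at t)"
      using DERIV_poly_power_exp[OF ds, of "bump_poly n" "2 * n"] by (simp add: p_def p'_def s_def)
    also have "p' * s ^ (2 * n) * exp (- s) + p * (2 * n * s ^ (2 * n - 1) * (2 * t * s\<^sup>2)) * exp (- s)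
        + p * s ^ (2 * n) * (exp (- s) * - (2 * t * s\<^sup>2)) = bump (Suc n) t"
    proof -
      \<comment> \<open>For \<open>n = 0\<close> the truncated exponent \<open>2 * n - 1\<close>
        breaks the power law, but then the factor \<open>real n\<close> vanishes.\<close>
      have e1: "real n * s ^ (2 * n - 1) * s\<^sup>2 = real n * s ^ (2 * n + 1)"
      proof (cases "n = 0")
        case False
        hence "2 * n - 1 + 2 = 2 * n + 1" by simp
        thus ?thesis by (simp only: mult.assoc power_add[symmetric])
      qed simp
      \<comment> \<open>Inserting powers of \<open>s * (1 - t^2) = 1\<close> brings every term to
        \<open>s ^ (2 * n + 2)\<close>, the power in \<open>bump (Suc n)\<close>.\<close>
      have e2: "s ^ (2 * n) = s ^ (2 * n + 2) * (1 - t\<^sup>2)\<^sup>2"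
      proof -
        have "s ^ (2 * n + 2) * (1 - t\<^sup>2)\<^sup>2 = s ^ (2 * n) * (s * (1 - t\<^sup>2))\<^sup>2"
          by (simp only: power_add power_mult_distrib mult.assoc)
        thus ?thesis by (simp add: s)
      qed
      have e3: "s ^ (2 * n + 1) = s ^ (2 * n + 2) * (1 - t\<^sup>2)"
      proof -
        have "s ^ (2 * n + 2) * (1 - t\<^sup>2) = s ^ (2 * n + 1) * (s * (1 - t\<^sup>2))" by simp
        thus ?thesis by (simp add: s)
      qed
      have "p * (2 * n * s ^ (2 * n - 1) * (2 * t * s\<^sup>2)) = 4 * t * p * (real n * s ^ (2 * n - 1) * s\<^sup>2)"
        by simp
      also have "\<dots> = 4 * t * p * (real n * (s ^ (2 * n + 2) * (1 - t\<^sup>2)))"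
        by (simp only: e1 e3)
      finally have e4: "p * (2 * n * s ^ (2 * n - 1) * (2 * t * s\<^sup>2)) = 4 * t * p * (real n * (s ^ (2 * n + 2) * (1 - t\<^sup>2)))" .
      have e5: "p * s ^ (2 * n) * (exp (- s) * - (2 * t * s\<^sup>2)) = - 2 * t * p * s ^ (2 * n + 2) * exp (- s)"
        by (simp add: power_add power2_eq_square)
      have pS: "poly (bump_poly (Suc n)) t = p' * (1 - t\<^sup>2)\<^sup>2 + 4 * n * t * (1 - t\<^sup>2) * p - 2 * t * p"
      proof -
        have "poly [:1, 0, -1:] t = 1 - t\<^sup>2" by (simp add: power2_eq_square)
        thus ?thesis by (simp only: bump_poly.simps poly_add poly_mult poly_diff poly_power p_def p'_def) simp
      qed
      have "bump (Suc n) t = (p' * (1 - t\<^sup>2)\<^sup>2 + 4 * n * t * (1 - t\<^sup>2) * p - 2 * t * p) * s ^ (2 * n + 2) * exp (- s)"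
        using 1 pS by (simp add: bump_def s_def)
      moreover have "p' * s ^ (2 * n) = p' * (s ^ (2 * n + 2) * (1 - t\<^sup>2)\<^sup>2)" using e2 by presburger
      moreover have "p' * (T * q\<^sup>2) * E + 4 * t * p * (real n * (T * q)) * E + - 2 * t * p * T * E
          = (p' * q\<^sup>2 + 4 * n * t * q * p - 2 * t * p) * T * E" for T q E :: real
        by (simp add: algebra_simps)
      ultimately show ?thesis unfolding e4 e5 by presburger
    qed
    finally have *: "((\<lambda>t. poly (bump_poly n) t * (1 / (1 - t\<^sup>2)) ^ (2 * n) * exp (- (1 / (1 - t\<^sup>2))))
       has_real_derivative bump (Suc n) t) (at t)" .
    show ?thesis
      by (rule has_field_derivative_transform_within_open[OF *, of "{-1<..<1}"])
         (use 1 in \<open>auto simp: bump_def abs_less_iff\<close>)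
  next
    case 2
    obtain K where K: "\<And>t. \<bar>t\<bar> < 1 \<Longrightarrow> \<bar>bump n t\<bar> \<le> K * (1 - t\<^sup>2)\<^sup>2"
      using bump_bound by blast
    have "\<bar>bump n 0\<bar> \<le> K" using K[of 0] by simp
    hence K0: "K \<ge> 0" by simp
    \<comment> \<open>The 4 is the square of the 2 in
      \<open>1 - x^2 = (1 - |x|) * (1 + |x|) <= 2 * |x - t|\<close>, which uses
      \<open>|t| = 1\<close>.\<close>
    have "\<bar>bump n x\<bar> \<le> (K * 4) * (x - t)\<^sup>2" for x
    proof (cases "\<bar>x\<bar> < 1")
      case True
      have "1 - x\<^sup>2 = (1 - \<bar>x\<bar>) * (1 + \<bar>x\<bar>)" by (simp add: algebra_simps power2_eq_square abs_mult_self_eq)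
      also have "\<dots> \<le> \<bar>x - t\<bar> * 2" using True 2 by (intro mult_mono) auto
      finally have "(1 - x\<^sup>2)\<^sup>2 \<le> (\<bar>x - t\<bar> * 2)\<^sup>2"
        using True by (intro power_mono) (auto simp: abs_square_le_1)
      hence "(1 - x\<^sup>2)\<^sup>2 \<le> 4 * (x - t)\<^sup>2" by (simp add: power_mult_distrib)
      hence "K * (1 - x\<^sup>2)\<^sup>2 \<le> K * (4 * (x - t)\<^sup>2)" using K0 by (intro mult_left_mono)
      with K[OF True] show ?thesis by simp
    qed (use K0 in \<open>auto simp: bump_def\<close>)
    moreover have "bump m t = 0" for m using 2 by (simp add: bump_def)
    ultimately show ?thesis using DERIV_zero_if_quadratic_bound[of "bump n" t "K * 4"] by simp
  next
    case 3
    hence out: "bump m t = 0" for m unfolding bump_def by simp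
    hence "((\<lambda>_. 0) has_real_derivative bump (Suc n) t) (at t)" by simp
    thus ?thesis
      by (rule has_field_derivative_transform_within_open[where S = "- {-1..1}"])
         (use 3 in \<open>force simp: bump_def\<close>)+
  qed
qed

lemma smooth_tower_bump:
  assumes "0 < \<delta>"
  shows "smooth_tower (\<lambda>n t. bump n ((t - x) / \<delta>) / \<delta> ^ n) (\<bar>x\<bar> + \<delta>)"
  unfolding smooth_tower_def
proof (intro conjI allI impI)
  fix n t
  have "((\<lambda>t. bump n ((t - x) / \<delta>)) has_real_derivative bump (Suc n) ((t - x) / \<delta>) * (1 / \<delta>)) (at t)"
    by (rule DERIV_chain2[OF bump_deriv]) (use assms in \<open>auto intro!: derivative_eq_intros\<close>)
  from DERIV_cdivide[OF this, of "\<delta> ^ n"]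
  show "((\<lambda>t. bump n ((t - x) / \<delta>) / \<delta> ^ n) has_real_derivative
      bump (Suc n) ((t - x) / \<delta>) / \<delta> ^ Suc n) (at t)" by (simp add: mult.commute)
next
  fix n t assume "\<bar>x\<bar> + \<delta> \<le> \<bar>t\<bar>"
  hence "\<delta> \<le> \<bar>t - x\<bar>" by linarith
  thus "bump n ((t - x) / \<delta>) / \<delta> ^ n = 0" using assms by (simp add: bump_def)
qed

lemma bump_0: "0 \<le> bump 0 t" "\<bar>t\<bar> < 1 \<Longrightarrow> 0 < bump 0 t" "1 \<le> \<bar>t\<bar> \<Longrightarrow> bump 0 t = 0"
  by (auto simp: bump_def)

text \<open>Fundamental lemma of the calculus of variations, tested with a bump around
  \<open>x\<close> so narrow that \<open>w\<close> keeps its sign on the support.\<close>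

lemma zero_if_orthogonal_to_smooth_towers:
  fixes w :: "real \<Rightarrow> real"
  assumes w: "continuous_on UNIV w"
    and orth: "\<And>D a. 0 < a \<Longrightarrow> smooth_tower D a \<Longrightarrow> integral {-a..a} (\<lambda>t. w t * D 0 t) = 0"
  shows "w x = 0"
proof (rule ccontr)
  assume "w x \<noteq> 0"
  hence "\<bar>w x\<bar> > 0" by simp
  then obtain \<delta> where \<delta>: "\<delta> > 0" "\<And>t. \<bar>t - x\<bar> < \<delta> \<Longrightarrow> \<bar>w t - w x\<bar> < \<bar>w x\<bar>"
    using w unfolding continuous_on_iff dist_real_def by blast
  define a where "a = \<bar>x\<bar> + \<delta>"
  define D where "D = (\<lambda>n t. bump n ((t - x) / \<delta>) / \<delta> ^ n)"
  have D: "smooth_tower D a" unfolding D_def a_def by (rule smooth_tower_bump[OF \<delta>(1)])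
  \<comment> \<open>The factor \<open>w x\<close> makes the integrand nonnegative whichever sign
    \<open>w x\<close> has.\<close>
  have nn: "0 \<le> w x * (w t * D 0 t)" for t
  proof (cases "\<bar>t - x\<bar> < \<delta>")
    case True
    have "0 \<le> w x * w t" using \<delta>(2)[OF True]
      by (auto simp: abs_if zero_le_mult_iff split: if_splits)
    thus ?thesis by (simp add: D_def bump_0 mult.assoc[symmetric])
  next
    case False
    thus ?thesis using \<delta>(1) by (simp add: D_def bump_0)
  qed
  have "a > 0" using \<delta> by (simp add: a_def)
  have "integral {-a..a} (\<lambda>t. w x * (w t * D 0 t)) = 0"
    using orth[OF \<open>a > 0\<close> D] by (simp add: integral_mult_right)
  moreover have "continuous_on {-a..a} (\<lambda>t. w x * (w t * D 0 t))"
    by (intro continuous_intros smooth_tower_continuous[OF D] continuous_on_subset[OF w]) auto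
  ultimately have "\<forall>t\<in>{-a..a}. w x * (w t * D 0 t) = 0"
    using nn integral_eq_0_iff[of "-a" a "\<lambda>t. w x * (w t * D 0 t)"] \<open>a > 0\<close> by auto
  moreover have "x \<in> {-a..a}" using \<delta>(1) by (auto simp: a_def)
  ultimately have "w x * (w x * D 0 x) = 0" by blast
  with \<open>w x \<noteq> 0\<close> bump_0(2)[of 0] show False by (simp add: D_def)
qed

subsection \<open>Local boundedness at the boundary\<close>

text \<open>Each sign is chosen so that the diagonal entry does not cancel against the preceding partial sum.\<close>

fun gliding_sign :: "(nat \<Rightarrow> nat \<Rightarrow> real) \<Rightarrow> nat \<Rightarrow> real" where
  "gliding_sign A n = (if 0 \<le> (\<Sum>j<n. gliding_sign A j * A n j) * A n n then 1 else -1)"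

declare gliding_sign.simps [simp del]

lemma abs_gliding_sign [simp]: "\<bar>gliding_sign A n\<bar> = 1"
  by (simp add: gliding_sign.simps[of A n])

lemma gliding_sign_partial_sum: "\<bar>A n n\<bar> \<le> \<bar>\<Sum>j<Suc n. gliding_sign A j * A n j\<bar>"
proof -
  define S where "S = (\<Sum>j<n. gliding_sign A j * A n j)"
  have "(\<Sum>j<Suc n. gliding_sign A j * A n j) = (if 0 \<le> S * A n n then S + A n n else S - A n n)"
    by (simp add: gliding_sign.simps[of A n] S_def)
  thus ?thesis by (auto simp: zero_le_mult_iff abs_if split: if_splits)
qed

text \<open>With ratio 1/3 the tail beyond the diagonal is at most half the diagonal entry, while
  the signs keep the partial sum through the diagonal at least as large as the whole entry; half of
  it survives.\<close>

lemma gliding_hump: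
  assumes A: "\<And>n j. \<bar>A n j\<bar> \<le> (1/3) ^ j * M n" and diag: "\<And>n. \<bar>A n n\<bar> = (1/3) ^ n * M n"
  shows "(1/3) ^ n * M n / 2 \<le> \<bar>\<Sum>j. gliding_sign A j * A n j\<bar>"
proof -
  let ?f = "\<lambda>j. gliding_sign A j * A n j"
  have le: "\<bar>?f j\<bar> \<le> (1/3) ^ j * M n" for j
    using A[of n j] by (simp add: abs_mult)
  have g: "(\<lambda>j. (1/3) ^ j * M n) sums (3/2 * M n)"
    using sums_mult2[OF geometric_sums[of "1/3::real"], of "M n"] by simp
  have sf: "summable (\<lambda>j. \<bar>?f j\<bar>)"
    by (rule summable_comparison_test[OF _ sums_summable[OF g]]) (use le in auto)
  hence sf': "summable ?f" by (rule summable_rabs_cancel)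
  have g': "(\<lambda>j. (1/3) ^ (j + Suc n) * M n) sums ((1/3) ^ n * M n / 2)"
    using sums_mult[OF g, of "(1/3) ^ Suc n"] by (simp add: power_add mult_ac)
  have "\<bar>\<Sum>j. ?f (j + Suc n)\<bar> \<le> (\<Sum>j. \<bar>?f (j + Suc n)\<bar>)"
    using summable_ignore_initial_segment[OF sf, of "Suc n"] by (rule summable_rabs)
  also have "\<dots> \<le> (\<Sum>j. (1/3) ^ (j + Suc n) * M n)"
    by (rule suminf_le) (rule le summable_ignore_initial_segment[OF sf] sums_summable[OF g'])+
  also have "\<dots> = (1/3) ^ n * M n / 2" using g' by (simp add: sums_iff)
  finally have "\<bar>\<Sum>j. ?f (j + Suc n)\<bar> \<le> (1/3) ^ n * M n / 2" .
  moreover have "(\<Sum>j. ?f j) = (\<Sum>j. ?f (j + Suc n)) + (\<Sum>j<Suc n. ?f j)"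
    using sf' by (rule suminf_split_initial_segment)
  moreover have "(1/3) ^ n * M n \<le> \<bar>\<Sum>j<Suc n. ?f j\<bar>"
    using gliding_sign_partial_sum[of A n] diag[of n] by simp
  ultimately show ?thesis by linarith
qed

text \<open>On the imaginary axis this pairs a horizontal slice of \<open>w\<close> with the test
  function \<open>D 0\<close>; moving \<open>Re z\<close> amounts to pairing with a translate. The
  higher entries of \<open>D\<close> enter through integration by parts.\<close>

definition smear :: "(complex \<Rightarrow> real) \<Rightarrow> (nat \<Rightarrow> real \<Rightarrow> real) \<Rightarrow> real \<Rightarrow> complex \<Rightarrow> real" where
  "smear w D a z = integral {-a..a} (\<lambda>t. w (z + of_real t) * D 0 t)"

lemma continuous_on_smear:
  assumes w: "continuous_on {z. 0 < Im z} w" and D: "smooth_tower D a"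
  shows "continuous_on {z. 0 < Im z} (smear w D a)"
proof -
  have "continuous_on ({z. 0 < Im z} \<times> cbox (-a) a) (\<lambda>(z, t). w (z + of_real t) * D 0 t)"
    unfolding split_beta
    by (intro continuous_intros continuous_on_compose2[OF w]
        continuous_on_compose2[OF smooth_tower_continuous[OF D, of UNIV]]) auto
  hence "continuous_on {z. 0 < Im z} (\<lambda>z. integral (cbox (-a) a) (\<lambda>t. w (z + of_real t) * D 0 t))"
    by (rule integral_continuous_on_param)
  thus ?thesis by (simp add: smear_def[abs_def])
qed

text \<open>Shifting the test function instead of the argument puts all translates on one interval,
  where they can be summed under a single integral.\<close>

lemma integral_translate_smooth_tower:
  fixes f :: "real \<Rightarrow> real"
  assumes f: "continuous_on UNIV f" and D: "smooth_tower D a" and x: "\<bar>x\<bar> + a \<le> b"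
  shows "((\<lambda>s. f s * D 0 (s - x)) has_integral (integral {-a..a} (\<lambda>t. f (x + t) * D 0 t))) {-b..b}"
proof -
  have cf: "continuous_on S (\<lambda>t. f (x + t) * D 0 t)" for S
    by (intro continuous_intros continuous_on_compose2[OF f] smooth_tower_continuous[OF D]) auto
  have "((\<lambda>t. f (x + t) * D 0 t) has_integral (integral {-a..a} (\<lambda>t. f (x + t) * D 0 t))) {-a..a}"
    by (intro integrable_integral integrable_continuous_real cf)
  hence "((\<lambda>t. f (x + t) * D 0 t) has_integral (integral {-a..a} (\<lambda>t. f (x + t) * D 0 t))) {-b-x..b-x}"
    by (rule has_integral_on_superset)
       (use x smooth_tower_zero[OF D, of _ 0] in \<open>force simp: abs_le_iff not_le\<close>)+
  hence "((\<lambda>s. f (x + (1 *\<^sub>R s + - x)) * D 0 (1 *\<^sub>R s + - x)) has_integral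
     (integral {-a..a} (\<lambda>t. f (x + t) * D 0 t))) {-b..b}"
    using has_integral_affinity[of _ _ "-b-x" "b-x" 1 "-x"] by fastforce
  thus ?thesis by simp
qed

text \<open>The completeness behind Banach--Steinhaus: geometric coefficients give uniform
  convergence for every derivative, and bounded shifts keep all supports inside one interval, so the
  sum is again an admissible test function.\<close>

lemma smooth_tower_series:
  assumes D: "smooth_tower D a" and c: "\<And>j. \<bar>c j\<bar> \<le> (1/3::real) ^ j" and x: "\<And>j. \<bar>x j\<bar> \<le> X"
  shows "smooth_tower (\<lambda>k s. \<Sum>j. c j * D k (s - x j)) (a + X)"
  unfolding smooth_tower_def
proof (intro conjI allI impI)
  fix k s
  have m: "uniformly_convergent_on UNIV (\<lambda>n s. \<Sum>i<n. c i * D k (s - x i))" for k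
  proof -
    obtain K where K: "K > 0" "\<And>x. \<bar>D k x\<bar> \<le> K" using smooth_tower_bounded[OF D] by blast
    show ?thesis
    proof (rule Weierstrass_m_test'[where M = "\<lambda>j. (1/3) ^ j * K"])
      show "norm (c j * D k (s - x j)) \<le> (1/3) ^ j * K" for j s
        unfolding norm_mult by (intro mult_mono) (use c K in auto)
    qed (intro summable_mult2 summable_geometric, simp)
  qed
  show "((\<lambda>s. \<Sum>j. c j * D k (s - x j)) has_real_derivative (\<Sum>j. c j * D (Suc k) (s - x j))) (at s)"
  proof (rule has_field_derivative_series'(2)[where S = UNIV])
    show "((\<lambda>s. c n * D k (s - x n)) has_real_derivative c n * D (Suc k) (s - x n)) (at s within UNIV)" for n s
      using DERIV_shift[of "D k" _ s "- x n"] smooth_tower_deriv[OF D, of k "s - x n"]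
      by (intro DERIV_cmult) simp
    show "summable (\<lambda>n. c n * D k (0 - x n))"
      using uniformly_convergent_imp_convergent[OF m, of 0 k] by (simp add: summable_iff_convergent)
  qed (use m in auto)
next
  fix k s assume s: "a + X \<le> \<bar>s\<bar>"
  have "D k (s - x j) = 0" for j
    by (rule smooth_tower_zero[OF D]) (use s x[of j] in linarith)
  thus "(\<Sum>j. c j * D k (s - x j)) = 0" by simp
qed

text \<open>Banach--Steinhaus on the absolutely convergent series of translates of one test function: if the
  conclusion failed, translating to the points \<open>x n\<close> where \<open>\<bar>smear w D a\<bar>\<close> is maximal at height \<open>y n\<close>
  would yield a test function \<open>E\<close> violating \<open>bd\<close>.\<close>

lemma smear_locally_bounded_at_boundary:
  assumes w: "continuous_on {z. 0 < Im z} w" and D: "smooth_tower D a" and "0 < a"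
    and bd: "\<And>D a. 0 < a \<Longrightarrow> smooth_tower D a \<Longrightarrow> ((\<lambda>y. smear w D a (Complex 0 y)) \<longlongrightarrow> 0) (at_right 0)"
  shows "\<exists>\<delta>>0. \<exists>B. \<forall>x y. \<bar>x\<bar> \<le> X \<longrightarrow> 0 < y \<longrightarrow> y < \<delta> \<longrightarrow> \<bar>smear w D a (Complex x y)\<bar> \<le> B"
proof (rule ccontr)
  assume contra: "\<not> ?thesis"
  define V where "V x y = smear w D a (Complex x y)" for x y
  \<comment> \<open>The size \<open>3 ^ n\<close> offsets the weight \<open>(1/3) ^ n\<close> of the
    n-th translate, and the bound on \<open>y\<close> forces the heights to 0.\<close>
  have "\<exists>x y. \<bar>x\<bar> \<le> X \<and> 0 < y \<and> y < 1 / Suc n \<and> 3 ^ n \<le> \<bar>V x y\<bar> \<and> (\<forall>x'. \<bar>x'\<bar> \<le> X \<longrightarrow> \<bar>V x' y\<bar> \<le> \<bar>V x y\<bar>)" for n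
  proof -
    obtain x0 y where y: "\<bar>x0\<bar> \<le> X" "0 < y" "y < 1 / Suc n" "3 ^ n < \<bar>V x0 y\<bar>"
      using contra unfolding V_def not_ex not_all not_imp de_Morgan_conj
      by (metis (no_types, lifting) not_le of_nat_0_less_iff zero_less_Suc zero_less_divide_1_iff)
    have "continuous_on {-X..X} (\<lambda>x. \<bar>V x y\<bar>)"
      unfolding V_def using y
      by (intro continuous_intros continuous_on_compose2[OF continuous_on_smear[OF w D]]) (auto simp: Complex_eq intro!: continuous_intros)
    moreover have "x0 \<in> {-X..X}" using y(1) by auto
    ultimately obtain x where x: "x \<in> {-X..X}" "\<forall>x'\<in>{-X..X}. \<bar>V x' y\<bar> \<le> \<bar>V x y\<bar>"
      using continuous_attains_sup[of "{-X..X}" "\<lambda>x. \<bar>V x y\<bar>"] by blast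
    have "\<bar>x\<bar> \<le> X" "\<forall>x'. \<bar>x'\<bar> \<le> X \<longrightarrow> \<bar>V x' y\<bar> \<le> \<bar>V x y\<bar>"
      using x by (auto simp: abs_le_iff)
    moreover have "3 ^ n \<le> \<bar>V x y\<bar>" using x(2) \<open>x0 \<in> {-X..X}\<close> y(4) by fastforce
    ultimately show ?thesis using y by blast
  qed
  then obtain x y where x: "\<And>n. \<bar>x n\<bar> \<le> X" and y: "\<And>n. 0 < y n" "\<And>n. y n < 1 / Suc n"
    and V: "\<And>n. 3 ^ n \<le> \<bar>V (x n) (y n)\<bar>" and Vmax: "\<And>n x'. \<bar>x'\<bar> \<le> X \<Longrightarrow> \<bar>V x' (y n)\<bar> \<le> \<bar>V (x n) (y n)\<bar>"
    by metis
  \<comment> \<open>Row \<open>n\<close> pairs the slice at height \<open>y n\<close> with all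
    weighted translates. Maximality of \<open>x n\<close> at that height bounds entry
    \<open>j\<close> by \<open>(1/3) ^ j * |V (x n) (y n)|\<close>, with equality on the diagonal,
    as \<open>gliding_hump\<close> requires.\<close>
  define A where "A n j = (1/3) ^ j * V (x j) (y n)" for n j
  define c where "c j = gliding_sign A j * (1/3) ^ j" for j
  define E where "E = (\<lambda>k s. \<Sum>j. c j * D k (s - x j))"
  define b where "b = a + X"
  have "0 \<le> X" using x[of 0] by linarith
  hence "0 < b" using \<open>0 < a\<close> by (simp add: b_def)
  have c: "\<bar>c j\<bar> \<le> (1/3) ^ j" for j by (simp add: c_def abs_mult)
  have E: "smooth_tower E b"
    unfolding E_def b_def by (rule smooth_tower_series[OF D c x])
  have sm: "smear w E b (Complex 0 (y n)) = (\<Sum>j. gliding_sign A j * A n j)" for n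
  proof -
    define f where "f s = w (Complex s (y n))" for s
    have cf: "continuous_on S f" for S
      unfolding f_def using y
      by (intro continuous_on_compose2[OF w]) (auto simp: Complex_eq intro!: continuous_intros)
    have "compact (f ` {-b..b})" by (intro compact_continuous_image cf) auto
    then obtain Kf where Kf: "Kf > 0" "\<And>s. s \<in> {-b..b} \<Longrightarrow> \<bar>f s\<bar> \<le> Kf"
      by (metis bounded_pos compact_imp_bounded imageI real_norm_def)
    obtain K where K: "K > 0" "\<And>x. \<bar>D 0 x\<bar> \<le> K" using smooth_tower_bounded[OF D] by blast
    let ?g = "\<lambda>j s. c j * (f s * D 0 (s - x j))"
    have "uniform_limit {-b..b} (\<lambda>N s. \<Sum>j<N. ?g j s) (\<lambda>s. \<Sum>j. ?g j s) sequentially"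
    proof (rule Weierstrass_m_test[where M = "\<lambda>j. (1/3) ^ j * (Kf * K)"])
      show "norm (?g j s) \<le> (1/3) ^ j * (Kf * K)" if "s \<in> {-b..b}" for j s
        unfolding norm_mult by (intro mult_mono) (use c K Kf that in auto)
    qed (intro summable_mult2 summable_geometric, simp)
    then obtain I J where I: "\<And>N. ((\<lambda>s. \<Sum>j<N. ?g j s) has_integral I N) {-b..b}"
      and J: "((\<lambda>s. \<Sum>j. ?g j s) has_integral J) {-b..b}" and IJ: "I \<longlonglongrightarrow> J"
    proof (rule uniform_limit_integral)
      show "continuous_on {-b..b} (\<lambda>s. \<Sum>j<N. ?g j s)" for N
        by (intro continuous_intros cf continuous_on_compose2[OF smooth_tower_continuous[OF D, of UNIV]]) auto
    qed auto
    have "((\<lambda>s. ?g j s) has_integral c j * V (x j) (y n)) {-b..b}" for j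
    proof -
      have "V (x j) (y n) = integral {-a..a} (\<lambda>t. f (x j + t) * D 0 t)"
        by (simp add: V_def smear_def f_def complex_eq_iff Complex_eq algebra_simps)
      thus ?thesis
        using integral_translate_smooth_tower[OF cf D, of "x j" b] x[of j]
        by (intro has_integral_mult_right) (simp add: b_def)
    qed
    hence "((\<lambda>s. \<Sum>j<N. ?g j s) has_integral (\<Sum>j<N. c j * V (x j) (y n))) {-b..b}" for N
      by (intro has_integral_sum) auto
    hence "I = (\<lambda>N. \<Sum>j<N. gliding_sign A j * A n j)"
      using has_integral_unique[OF I] by (simp add: c_def A_def mult.assoc fun_eq_iff)
    with IJ have "(\<lambda>j. gliding_sign A j * A n j) sums J"
      by (simp add: sums_def)
    moreover have "smear w E b (Complex 0 (y n)) = J"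
    proof -
      have "(\<Sum>j. ?g j s) = f s * E 0 s" for s
      proof -
        have "summable (\<lambda>j. c j * D 0 (s - x j))"
          by (rule summable_comparison_test'[of "\<lambda>j. (1/3) ^ j * K"])
             (use c K in \<open>auto intro!: mult_mono summable_mult2 summable_geometric simp: norm_mult abs_mult\<close>)
        from suminf_mult[OF this, of "f s"] show ?thesis
          by (simp add: E_def mult_ac)
      qed
      with J have "((\<lambda>s. f s * E 0 s) has_integral J) {-b..b}" by simp
      thus ?thesis by (simp add: smear_def f_def Complex_eq algebra_simps integral_unique)
    qed
    ultimately show ?thesis by (simp add: sums_iff)
  qed
  have "1 / 2 \<le> \<bar>smear w E b (Complex 0 (y n))\<bar>" for n
  proof -
    have "(1/3) ^ n * \<bar>V (x n) (y n)\<bar> / 2 \<le> \<bar>\<Sum>j. gliding_sign A j * A n j\<bar>"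
      by (rule gliding_hump[where M = "\<lambda>n. \<bar>V (x n) (y n)\<bar>"]) (auto simp: A_def abs_mult intro!: Vmax x)
    moreover have "(1/3) ^ n * 3 ^ n \<le> (1/3) ^ n * \<bar>V (x n) (y n)\<bar>"
      using V by (intro mult_left_mono) auto
    moreover have "(1/3) ^ n * 3 ^ n = (1::real)" by (simp add: power_mult_distrib[symmetric])
    ultimately show ?thesis by (simp add: sm)
  qed
  moreover have "(\<lambda>n. smear w E b (Complex 0 (y n))) \<longlonglongrightarrow> 0"
  proof (rule filterlim_compose[OF bd[OF \<open>0 < b\<close> E]])
    have "y \<longlonglongrightarrow> 0"
      by (rule tendsto_sandwich[OF _ _ tendsto_const LIMSEQ_inverse_real_of_nat])
         (use y in \<open>auto intro!: always_eventually less_imp_le simp: inverse_eq_divide simp del: of_nat_Suc\<close>)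
    moreover have "y n \<noteq> 0" for n using y(1)[of n] by simp
    ultimately show "filterlim y (at_right 0) sequentially"
      using y(1) by (simp add: filterlim_at)
  qed
  ultimately show False
    using LIMSEQ_le_const[OF tendsto_rabs, of "\<lambda>n. smear w E b (Complex 0 (y n))" 0 "1/2"] by auto
qed

subsection \<open>Extension across the real line\<close>

abbreviation (input) uhp :: "complex set" where "uhp \<equiv> {z. 0 < Im z}"

definition csmear :: "(complex \<Rightarrow> complex) \<Rightarrow> (nat \<Rightarrow> real \<Rightarrow> real) \<Rightarrow> real \<Rightarrow> complex \<Rightarrow> complex" where
  "csmear h D a z = integral {-a..a} (\<lambda>t. h (z + of_real t) * of_real (D 0 t))"

lemma continuous_on_csmear_integrand:
  fixes h :: "complex \<Rightarrow> complex"
  assumes "continuous_on uhp h" "smooth_tower D a" "z \<in> uhp"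
  shows "continuous_on S (\<lambda>t. h (z + of_real t) * of_real (D n t))"
  by (intro continuous_intros continuous_on_compose2[OF assms(1)] smooth_tower_continuous[OF assms(2)])
     (use assms(3) in auto)

lemma csmear_Im:
  assumes "continuous_on uhp h" "smooth_tower D a" "z \<in> uhp"
  shows "Im (csmear h D a z) = smear (\<lambda>z. Im (h z)) D a z"
proof -
  have "(\<lambda>t. h (z + of_real t) * of_real (D 0 t)) integrable_on {-a..a}"
    by (intro integrable_continuous_real continuous_on_csmear_integrand[OF assms])
  from integral_linear[OF this bounded_linear_Im] show ?thesis
    by (simp add: csmear_def smear_def o_def)
qed

lemma csmear_has_field_derivative:
  assumes h: "h holomorphic_on uhp" and D: "smooth_tower D a" and z: "z \<in> uhp"
  shows "(csmear h D a has_field_derivative csmear (deriv h) D a z) (at z)"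
proof -
  have op: "open uhp" by (rule open_halfspace_Im_gt)
  have h': "continuous_on uhp (deriv h)"
    by (intro holomorphic_on_imp_continuous_on holomorphic_deriv h op)
  have "((\<lambda>z. integral (cbox (-a) a) (\<lambda>t. h (z + of_real t) * of_real (D 0 t))) has_field_derivative
    integral (cbox (-a) a) (\<lambda>t. deriv h (z + of_real t) * of_real (D 0 t))) (at z within uhp)"
  proof (rule leibniz_rule_field_derivative)
    fix z t assume z: "z \<in> uhp"
    have "((\<lambda>z. h (z + of_real t)) has_field_derivative deriv h (z + of_real t)) (at z)"
      by (rule DERIV_shift[THEN iffD1, OF holomorphic_derivI[OF h op]]) (use z in auto)
    thus "((\<lambda>z. h (z + of_real t) * of_real (D 0 t)) has_field_derivative
       deriv h (z + of_real t) * of_real (D 0 t)) (at z within uhp)"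
      by (rule has_field_derivative_at_within[OF DERIV_cmult_right])
    show "(\<lambda>t. h (z + of_real t) * of_real (D 0 t)) integrable_on cbox (-a) a"
      unfolding cbox_interval
      by (intro integrable_continuous_real continuous_on_csmear_integrand[OF _ D]
          holomorphic_on_imp_continuous_on h z)
  next
    show "continuous_on (uhp \<times> cbox (-a) a) (\<lambda>(z, t). deriv h (z + of_real t) * of_real (D 0 t))"
      unfolding split_beta
      by (intro continuous_intros continuous_on_compose2[OF h']
          continuous_on_compose2[OF smooth_tower_continuous[OF D, of UNIV]]) auto
  qed (use z convex_halfspace_Im_gt in auto)
  thus ?thesis using at_within_open[OF z op] by (simp add: csmear_def[abs_def])
qed

text \<open>Integration by parts, without boundary terms because \<open>D 0\<close> vanishes at both
  ends. Derivatives of \<open>h\<close>, about which nothing is assumed at the boundary, are thereby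
  moved onto the test function.\<close>

lemma csmear_deriv:
  assumes h: "h holomorphic_on uhp" and D: "smooth_tower D a" and a: "0 < a" and z: "z \<in> uhp"
  shows "csmear (deriv h) D a z = - csmear h (\<lambda>n. D (n + 1)) a z"
proof -
  have op: "open uhp" by (rule open_halfspace_Im_gt)
  have h': "continuous_on uhp (deriv h)"
    by (intro holomorphic_on_imp_continuous_on holomorphic_deriv h op)
  let ?F = "\<lambda>t. h (z + of_real t) * of_real (D 0 t)"
  let ?f1 = "\<lambda>t. deriv h (z + of_real t) * of_real (D 0 t)"
  let ?f2 = "\<lambda>t. h (z + of_real t) * of_real (D 1 t)"
  have i1: "((\<lambda>t. ?f1 t + ?f2 t) has_integral (?F a - ?F (-a))) {-a..a}"
  proof (rule fundamental_theorem_of_calculus)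
    fix t
    have 1: "((\<lambda>t. z + of_real t) has_vector_derivative 1) (at t)"
      by (auto intro!: derivative_eq_intros)
    have "(h \<circ> (\<lambda>t. z + of_real t) has_vector_derivative 1 * deriv h (z + of_real t)) (at t)"
      by (rule field_vector_diff_chain_at[OF 1]) (use holomorphic_derivI[OF h op] z in auto)
    moreover have "((\<lambda>t. complex_of_real (D 0 t)) has_vector_derivative of_real (D 1 t)) (at t)"
      using smooth_tower_deriv[OF D, of 0 t]
      by (intro has_vector_derivative_of_real) (simp add: has_real_derivative_iff_has_vector_derivative)
    ultimately have "(?F has_vector_derivative (h (z + of_real t) * of_real (D 1 t)
        + deriv h (z + of_real t) * of_real (D 0 t))) (at t)"
      using has_vector_derivative_mult[of "\<lambda>t. h (z + of_real t)" _ t UNIV "\<lambda>t. complex_of_real (D 0 t)"]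
      by (simp add: o_def)
    thus "(?F has_vector_derivative ?f1 t + ?f2 t) (at t within {-a..a})"
      by (simp add: has_vector_derivative_at_within add.commute)
  qed (use a in auto)
  have "?F a - ?F (-a) = 0"
    using smooth_tower_zero[OF D, of a 0] smooth_tower_zero[OF D, of "-a" 0] by simp
  moreover have i2: "((\<lambda>t. ?f1 t + ?f2 t) has_integral (integral {-a..a} ?f1 + integral {-a..a} ?f2)) {-a..a}"
    by (intro has_integral_add integrable_integral integrable_continuous_real
        continuous_on_csmear_integrand[OF _ D z] h' holomorphic_on_imp_continuous_on[OF h])
  ultimately have "integral {-a..a} ?f1 + integral {-a..a} ?f2 = 0"
    using has_integral_unique[OF i2 i1] by simp
  thus ?thesis by (simp add: csmear_def add_eq_0_iff)
qed

lemma higher_deriv_csmear: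
  assumes h: "h holomorphic_on uhp" and D: "smooth_tower D a" and z: "z \<in> uhp"
  shows "(deriv ^^ n) (csmear h D a) z = csmear ((deriv ^^ n) h) D a z"
  using z
proof (induction n arbitrary: z)
  case (Suc n)
  have op: "open uhp" by (rule open_halfspace_Im_gt)
  have "(csmear ((deriv ^^ n) h) D a has_field_derivative csmear ((deriv ^^ Suc n) h) D a z) (at z)"
    using csmear_has_field_derivative[OF holomorphic_higher_deriv[OF h op, of n] D Suc.prems] by simp
  hence "((deriv ^^ n) (csmear h D a) has_field_derivative csmear ((deriv ^^ Suc n) h) D a z) (at z)"
    by (rule has_field_derivative_transform_within_open[OF _ op Suc.prems]) (use Suc.IH in auto)
  thus ?case by (simp add: DERIV_imp_deriv)
qed simp

text \<open>Only imaginary parts are controlled at the boundary, but they are so for all derivatives, these being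
  smeared with derivatives of the test function. The vertical derivative of \<open>Re g'\<close> is \<open>- Im g''\<close>.\<close>

lemma csmear_lipschitz_at_boundary:
  assumes h: "h holomorphic_on uhp" and D: "smooth_tower D a" and a: "0 < a" and X: "0 < X"
    and bd: "\<And>D a. 0 < a \<Longrightarrow> smooth_tower D a \<Longrightarrow>
      ((\<lambda>y. smear (\<lambda>z. Im (h z)) D a (Complex 0 y)) \<longlongrightarrow> 0) (at_right 0)"
  shows "\<exists>\<delta>>0. \<exists>L. L-lipschitz_on {z. \<bar>Re z\<bar> < X \<and> 0 < Im z \<and> Im z < \<delta>} (csmear h D a)"
proof -
  have ch: "continuous_on uhp h" by (rule holomorphic_on_imp_continuous_on[OF h])
  hence cw: "continuous_on uhp (\<lambda>z. Im (h z))" by (intro continuous_intros)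
  define D1 where "D1 = (\<lambda>n. D (n + 1))"
  define D2 where "D2 = (\<lambda>n. D1 (n + 1))"
  have D1: "smooth_tower D1 a" unfolding D1_def by (rule smooth_tower_shift[OF D])
  have D2: "smooth_tower D2 a" unfolding D2_def by (rule smooth_tower_shift[OF D1])
  define g' where "g' z = - csmear h D1 a z" for z
  define g'' where "g'' z = csmear h D2 a z" for z
  have dg: "(csmear h D a has_field_derivative g' z) (at z)" if "z \<in> uhp" for z
    using csmear_has_field_derivative[OF h D that] csmear_deriv[OF h D a that] by (simp add: g'_def D1_def)
  have dg': "(g' has_field_derivative g'' z) (at z)" if "z \<in> uhp" for z
    using DERIV_minus[OF csmear_has_field_derivative[OF h D1 that]] csmear_deriv[OF h D1 a that]
    by (simp add: g'_def[abs_def] g''_def D2_def)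
  have im: "Im (g' z) = - smear (\<lambda>z. Im (h z)) D1 a z" "Im (g'' z) = smear (\<lambda>z. Im (h z)) D2 a z"
    if "z \<in> uhp" for z
    using csmear_Im[OF ch D1 that] csmear_Im[OF ch D2 that] by (simp_all add: g'_def g''_def)
  obtain \<delta>1 B1 where 1: "\<delta>1 > 0" "\<And>x y. \<bar>x\<bar> \<le> X \<Longrightarrow> 0 < y \<Longrightarrow> y < \<delta>1 \<Longrightarrow> \<bar>Im (g' (Complex x y))\<bar> \<le> B1"
    using smear_locally_bounded_at_boundary[OF cw D1 a bd, of X] im(1) by (metis (mono_tags, lifting) abs_minus_cancel complex.sel(2) mem_Collect_eq)
  obtain \<delta>2 B2 where 2: "\<delta>2 > 0" "\<And>x y. \<bar>x\<bar> \<le> X \<Longrightarrow> 0 < y \<Longrightarrow> y < \<delta>2 \<Longrightarrow> \<bar>Im (g'' (Complex x y))\<bar> \<le> B2"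
    using smear_locally_bounded_at_boundary[OF cw D2 a bd, of X] im(2) by (metis (mono_tags, lifting) complex.sel(2) mem_Collect_eq)
  define \<delta> where "\<delta> = min \<delta>1 \<delta>2"
  have \<delta>: "0 < \<delta>" using 1 2 by (simp add: \<delta>_def)
  have cg': "continuous_on uhp g'"
    using dg' by (intro DERIV_continuous_on) (auto intro: has_field_derivative_at_within)
  \<comment> \<open>The segment at height \<open>\<delta>/2\<close> lies inside the half-plane, so
    \<open>g'\<close> is bounded there. From it the bound on \<open>Im g''\<close> carries
    \<open>Re g'\<close> vertically, which explains the summands \<open>P\<close> and
    \<open>B2 * \<delta>\<close> of \<open>L\<close>.\<close>
  have "compact ((\<lambda>x. g' (Complex x (\<delta>/2))) ` {-X..X})"
    using \<delta> by (intro compact_continuous_image continuous_on_compose2[OF cg'])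
      (auto simp: Complex_eq intro!: continuous_intros)
  then obtain P where P: "P > 0" "\<And>x. x \<in> {-X..X} \<Longrightarrow> norm (g' (Complex x (\<delta>/2))) \<le> P"
    by (metis (no_types, lifting) bounded_pos compact_imp_bounded imageI)
  define L where "L = B1 + (P + B2 * \<delta>)"
  let ?Q = "{z. \<bar>Re z\<bar> < X \<and> 0 < Im z \<and> Im z < \<delta>}"
  have B2: "0 \<le> B2" using 2(2)[of 0 "\<delta>2 / 2"] 2(1) X by linarith
  have B1: "0 \<le> B1" using 1(2)[of 0 "\<delta>1 / 2"] 1(1) X by linarith
  have bound: "norm (g' z) \<le> L" if "z \<in> ?Q" for z
  proof -
    define x y where "x = Re z" and "y = Im z"
    have z: "z = Complex x y" by (simp add: x_def y_def)
    have xy: "\<bar>x\<bar> \<le> X" "0 < y" "y < \<delta>" using that by (auto simp: x_def y_def)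
    have im: "\<bar>Im (g' z)\<bar> \<le> B1" using 1(2) xy by (simp add: z \<delta>_def)
    have der: "((\<lambda>s. Re (g' (Complex x s))) has_real_derivative - Im (g'' (Complex x s))) (at s)" if "0 < s" for s
    proof -
      have "((\<lambda>s. Complex x s) has_vector_derivative \<i>) (at s)"
        unfolding Complex_eq by (auto intro!: derivative_eq_intros)
      hence "(g' \<circ> (\<lambda>s. Complex x s) has_vector_derivative \<i> * g'' (Complex x s)) (at s)"
        by (rule field_vector_diff_chain_at) (use dg' that in auto)
      from bounded_linear.has_vector_derivative[OF bounded_linear_Re this] show ?thesis
        by (simp add: has_real_derivative_iff_has_vector_derivative o_def)
    qed
    have "norm (Re (g' (Complex x y)) - Re (g' (Complex x (\<delta>/2)))) \<le> B2 * norm (y - \<delta>/2)"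
    proof (rule field_differentiable_bound[where S = "{0<..<\<delta>}"])
      show "((\<lambda>s. Re (g' (Complex x s))) has_real_derivative - Im (g'' (Complex x s))) (at s within {0<..<\<delta>})"
        if "s \<in> {0<..<\<delta>}" for s using der that by (auto intro: has_field_derivative_at_within)
      show "norm (- Im (g'' (Complex x s))) \<le> B2" if "s \<in> {0<..<\<delta>}" for s
        using 2(2)[of x s] xy that by (simp add: \<delta>_def)
    qed (use xy \<delta> in auto)
    also have "\<dots> \<le> B2 * \<delta>" using B2 xy by (intro mult_left_mono) auto
    finally have "\<bar>Re (g' (Complex x y)) - Re (g' (Complex x (\<delta>/2)))\<bar> \<le> B2 * \<delta>" by simp
    moreover have "\<bar>Re (g' (Complex x (\<delta>/2)))\<bar> \<le> P"
      using P(2)[of x] abs_Re_le_cmod[of "g' (Complex x (\<delta>/2))"] xy by (auto simp: abs_le_iff)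
    ultimately have "\<bar>Re (g' z)\<bar> \<le> P + B2 * \<delta>" by (simp add: z)
    with im cmod_le[of "g' z"] show ?thesis by (simp add: L_def)
  qed
  have cvx: "convex ?Q"
  proof -
    have "?Q = Re -` {-X<..<X} \<inter> Im -` {0<..<\<delta>}" by auto
    thus ?thesis
      by (auto intro!: convex_Int convex_linear_vimage bounded_linear.linear[OF bounded_linear_Re] bounded_linear.linear[OF bounded_linear_Im])
  qed
  have "L-lipschitz_on ?Q (csmear h D a)"
  proof (rule lipschitz_onI)
    show "dist (csmear h D a z) (csmear h D a w) \<le> L * dist z w" if "z \<in> ?Q" "w \<in> ?Q" for z w
      unfolding dist_norm
    proof (rule field_differentiable_bound[OF cvx _ bound that])
      show "(csmear h D a has_field_derivative g' z) (at z within ?Q)" if "z \<in> ?Q" for z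
        using dg that by (auto intro: has_field_derivative_at_within)
    qed
    show "0 \<le> L" using B1 B2 P(1) \<delta> by (simp add: L_def)
  qed
  with \<delta> show ?thesis by blast
qed

section \<open>Translation, boundary values and reflection\<close>

lemma smear_translate:
  assumes w: "continuous_on uhp w" and D: "smooth_tower D a" and x: "\<bar>x\<bar> + a \<le> b" and y: "0 < y"
  shows "smear w (\<lambda>n s. D n (s - x)) b (Complex 0 y) = smear w D a (Complex x y)"
proof -
  have "continuous_on UNIV (\<lambda>s. w (Complex s y))"
    by (intro continuous_on_compose2[OF w]) (use y in \<open>auto simp: Complex_eq intro!: continuous_intros\<close>)
  from integral_unique[OF integral_translate_smooth_tower[OF this D x]] show ?thesis
    by (simp add: smear_def Complex_eq algebra_simps)
qed

lemma smooth_tower_translate: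
  assumes D: "smooth_tower D a" and x: "\<bar>x\<bar> + a \<le> b"
  shows "smooth_tower (\<lambda>n s. D n (s - x)) b"
  unfolding smooth_tower_def
proof (intro conjI allI impI)
  show "((\<lambda>s. D n (s - x)) has_real_derivative D (Suc n) (s - x)) (at s)" for n s
    using DERIV_shift[of "D n" _ s "- x"] smooth_tower_deriv[OF D, of n "s - x"] by simp
  show "D n (s - x) = 0" if "b \<le> \<bar>s\<bar>" for n s
    by (rule smooth_tower_zero[OF D]) (use that x in linarith)
qed

lemma closed_uhp_closure:
  assumes "0 \<le> Im z" "\<bar>Re z\<bar> < X" "Im z < \<delta>"
  shows "z \<in> closure {z. \<bar>Re z\<bar> < X \<and> 0 < Im z \<and> Im z < \<delta>}"
  unfolding closure_approachable
proof (intro allI impI)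
  fix e :: real assume e: "0 < e"
  define t where "t = min (e / 2) ((\<delta> - Im z) / 2)"
  have t: "0 < t" "t < e" "Im z + t < \<delta>"
    using e assms by (auto simp: t_def min_def field_simps)
  have "dist (z + \<i> * of_real t) z < e" using t by (simp add: dist_norm norm_mult)
  moreover have "z + \<i> * of_real t \<in> {z. \<bar>Re z\<bar> < X \<and> 0 < Im z \<and> Im z < \<delta>}" using t assms by simp
  ultimately show "\<exists>y\<in>{z. \<bar>Re z\<bar> < X \<and> 0 < Im z \<and> Im z < \<delta>}. dist y z < e" by blast
qed

lemma at_within_uhp_nontrivial:
  assumes "Im z = 0" shows "at z within uhp \<noteq> bot"
proof -
  have "z islimpt uhp"
    unfolding islimpt_approachable
  proof (intro allI impI)
    fix e :: real assume "0 < e"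
    thus "\<exists>x'\<in>uhp. x' \<noteq> z \<and> dist x' z < e"
      using assms by (intro bexI[of _ "z + \<i> * of_real (e / 2)"]) (auto simp: dist_norm norm_mult)
  qed
  thus ?thesis by (simp add: trivial_limit_within)
qed

text \<open>The conjugation symmetry is recorded because the growth estimate is known only in the
  upper half-plane and has to be carried to the lower one.\<close>

lemma csmear_extends_to_entire:
  assumes h: "h holomorphic_on uhp" and D: "smooth_tower D a" and a: "0 < a"
    and bd: "\<And>D a. 0 < a \<Longrightarrow> smooth_tower D a \<Longrightarrow>
      ((\<lambda>y. smear (\<lambda>z. Im (h z)) D a (Complex 0 y)) \<longlongrightarrow> 0) (at_right 0)"
  obtains F where "F holomorphic_on UNIV" "\<And>z. z \<in> uhp \<Longrightarrow> F z = csmear h D a z"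
    "\<And>z. F (cnj z) = cnj (F z)"
proof -
  define g where "g = csmear h D a"
  have op: "open uhp" by (rule open_halfspace_Im_gt)
  have ch: "continuous_on uhp h" by (rule holomorphic_on_imp_continuous_on[OF h])
  hence cw: "continuous_on uhp (\<lambda>z. Im (h z))" by (intro continuous_intros)
  have g: "g holomorphic_on uhp"
    using csmear_has_field_derivative[OF h D] op by (auto simp: g_def holomorphic_on_open)
  hence cg: "continuous_on uhp g" by (rule holomorphic_on_imp_continuous_on)
  \<comment> \<open>The hypothesis concerns real part 0; translating the test function yields the
    limit on every vertical line.\<close>
  have limIm: "((\<lambda>y. Im (g (Complex x y))) \<longlongrightarrow> 0) (at_right 0)" for x
  proof -
    have "((\<lambda>y. smear (\<lambda>z. Im (h z)) (\<lambda>n s. D n (s - x)) (\<bar>x\<bar> + a) (Complex 0 y)) \<longlongrightarrow> 0) (at_right 0)"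
      by (rule bd) (use a in \<open>auto intro!: smooth_tower_translate[OF D]\<close>)
    moreover have "\<forall>\<^sub>F y in at_right 0. smear (\<lambda>z. Im (h z)) (\<lambda>n s. D n (s - x)) (\<bar>x\<bar> + a) (Complex 0 y)
        = Im (g (Complex x y))"
      unfolding eventually_at_filter
      by (intro always_eventually) (auto simp: g_def csmear_Im[OF ch D] smear_translate[OF cw D])
    ultimately show ?thesis by (rule Lim_transform_eventually)
  qed
  let ?H = "{z. 0 \<le> Im z}"
  \<comment> \<open>Defining the boundary values by one global limit spares any gluing: each local
    Lipschitz extension \<open>k\<close> below agrees with \<open>E\<close>.\<close>
  define E where "E z = (if 0 < Im z then g z else Lim (at z within uhp) g)" for z
  have bdry: "(g \<longlongrightarrow> E z) (at z within uhp) \<and> (\<exists>T. open T \<and> z \<in> T \<and> continuous_on (T \<inter> ?H) E)"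
    if z: "Im z = 0" for z
  proof -
    define X where "X = \<bar>Re z\<bar> + 1"
    obtain \<delta> L where \<delta>: "\<delta> > 0" and lip: "L-lipschitz_on {z. \<bar>Re z\<bar> < X \<and> 0 < Im z \<and> Im z < \<delta>} g"
      using csmear_lipschitz_at_boundary[OF h D a _ bd, of X] unfolding g_def X_def by force
    define Q where "Q = {z. \<bar>Re z\<bar> < X \<and> 0 < Im z \<and> Im z < \<delta>}"
    define T where "T = {z. \<bar>Re z\<bar> < X \<and> Im z < \<delta>}"
    have oT: "open T" unfolding T_def by (intro open_Collect_conj open_Collect_less continuous_intros)
    have zT: "z \<in> T" using z \<delta> by (simp add: T_def X_def)
    obtain k where k: "L-lipschitz_on (closure Q) k" "\<And>z. z \<in> Q \<Longrightarrow> k z = g z"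
      using lipschitz_extend_closure[OF lip] unfolding Q_def by blast
    have sub: "T \<inter> ?H \<subseteq> closure Q" using closed_uhp_closure by (auto simp: T_def Q_def)
    have ck: "continuous_on (T \<inter> ?H) k"
      using lipschitz_on_continuous_on[OF k(1)] sub by (rule continuous_on_subset)
    have lim: "(g \<longlongrightarrow> k z) (at z within uhp)" if "z \<in> T" "Im z = 0" for z
    proof -
      have "(k \<longlongrightarrow> k z) (at z within T \<inter> ?H)"
        using ck that by (auto simp: continuous_on_def)
      hence "(k \<longlongrightarrow> k z) (at z within T \<inter> uhp)"
        by (rule tendsto_within_subset) auto
      moreover have "\<forall>\<^sub>F x in at z within T \<inter> uhp. k x = g x"
        unfolding eventually_at_filter
        by (intro always_eventually) (auto simp: T_def intro!: k(2) simp: Q_def)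
      ultimately have "(g \<longlongrightarrow> k z) (at z within T \<inter> uhp)" by (rule Lim_transform_eventually)
      moreover have "at z within T \<inter> uhp = at z within uhp"
        by (rule at_within_nhd[of _ T]) (use that oT in auto)
      ultimately show ?thesis by simp
    qed
    have Ek: "E z = k z" if "z \<in> T \<inter> ?H" for z
    proof (cases "0 < Im z")
      case True
      thus ?thesis using that by (auto simp: E_def k(2) Q_def T_def)
    next
      case False
      hence "Im z = 0" using that by auto
      thus ?thesis using lim[of z] that at_within_uhp_nontrivial[of z] tendsto_Lim by (auto simp: E_def)
    qed
    have "continuous_on (T \<inter> ?H) E" using ck by (rule continuous_on_eq) (simp add: Ek)
    moreover have "(g \<longlongrightarrow> E z) (at z within uhp)"
      using lim[OF zT z] Ek[of z] zT z by simp
    ultimately show ?thesis using oT zT by blast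
  qed
  have cE: "continuous_on ?H E"
  proof -
    have "\<exists>T. open T \<and> z \<in> T \<and> continuous_on (T \<inter> ?H) E" if "z \<in> ?H" for z
    proof (cases "0 < Im z")
      case True
      have "continuous_on (uhp \<inter> ?H) E"
        by (rule continuous_on_eq[OF continuous_on_subset[OF cg]]) (auto simp: E_def)
      with op True show ?thesis by blast
    next
      case False
      with bdry[of z] that show ?thesis by auto
    qed
    then have "(E \<longlongrightarrow> E z) (at z within ?H)" if z: "z \<in> ?H" for z
    proof -
      obtain T where T: "open T" "z \<in> T" "continuous_on (T \<inter> ?H) E"
        using \<open>\<And>z. z \<in> ?H \<Longrightarrow> \<exists>T. open T \<and> z \<in> T \<and> continuous_on (T \<inter> ?H) E\<close> z by blast
      have "(E \<longlongrightarrow> E z) (at z within T \<inter> ?H)" using T z by (simp add: continuous_on_def)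
      moreover have "at z within T \<inter> ?H = at z within ?H"
        by (rule at_within_nhd[of _ T]) (use T in auto)
      ultimately show ?thesis by simp
    qed
    thus ?thesis by (simp add: continuous_on_def)
  qed
  have real: "Im (E z) = 0" if z: "Im z = 0" for z
  proof -
    \<comment> \<open>The limit through the whole half-plane restricts to vertical approach, where
      \<open>limIm\<close> applies.\<close>
    have "filterlim (\<lambda>y. Complex (Re z) y) (at z within uhp) (at_right 0)"
      unfolding filterlim_at
    proof
      have "((\<lambda>y. Complex (Re z) y) \<longlongrightarrow> Complex (Re z) 0) (at_right 0)"
        by (intro tendsto_intros)
      moreover have "Complex (Re z) 0 = z" using z by (simp add: complex_eq_iff)
      ultimately show "((\<lambda>y. Complex (Re z) y) \<longlongrightarrow> z) (at_right 0)" by simp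
      show "\<forall>\<^sub>F y in at_right 0. Complex (Re z) y \<in> uhp \<and> Complex (Re z) y \<noteq> z"
        unfolding eventually_at_filter by (intro always_eventually) (use z in \<open>auto simp: complex_eq_iff\<close>)
    qed
    hence "((\<lambda>y. Im (g (Complex (Re z) y))) \<longlongrightarrow> Im (E z)) (at_right 0)"
      using bdry[OF z] by (intro tendsto_Im) (blast intro: filterlim_compose)
    with limIm[of "Re z"] show ?thesis
      using tendsto_unique trivial_limit_at_right_real by blast
  qed
  define F where "F = (\<lambda>z. if 0 \<le> Im z then E z else cnj (E (cnj z)))"
  show ?thesis
  proof (rule that[of F])
    show "F holomorphic_on UNIV"
      unfolding F_def
    proof (rule Schwarz_reflection)
      show "E holomorphic_on UNIV \<inter> {z. 0 < Im z}"
        using g by (rule holomorphic_transform[of g, THEN holomorphic_on_subset]) (auto simp: E_def)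
      show "E z \<in> \<real>" if "z \<in> \<real>" for z
        using real[of z] that by (simp add: complex_is_Real_iff)
    qed (use cE in auto)
    show "F z = csmear h D a z" if "z \<in> uhp" for z
      using that by (simp add: F_def E_def g_def)
    show "F (cnj z) = cnj (F z)" for z
    proof (cases "Im z = 0")
      case True
      hence "cnj z = z" "cnj (E z) = E z" using real[OF True] by (auto simp: complex_eq_iff)
      thus ?thesis using True by (simp add: F_def)
    qed (auto simp: F_def)
  qed
qed

subsection \<open>Entire functions with imaginary part of temperate growth\<close>

text \<open>Cauchy's formula as an average over the circle parameter. In this form complex
  conjugation passes directly under the integral, which is needed for \<open>cnj F\<close>.\<close>

lemma entire_fourier_coefficient:
  assumes F: "F holomorphic_on UNIV" and r: "0 < r"
  shows "((\<lambda>t. F (circlepath 0 r t) / circlepath 0 r t ^ k) has_integral ((deriv ^^ k) F 0 / fact k)) {0..1}"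
proof -
  have "((\<lambda>u. F u / (u - 0) ^ Suc k) has_contour_integral ((2 * pi * \<i>) / (fact k) * (deriv ^^ k) F 0)) (circlepath 0 r)"
    by (rule Cauchy_has_contour_integral_higher_derivative_circlepath)
       (use F r in \<open>auto intro: holomorphic_on_subset holomorphic_on_imp_continuous_on\<close>)
  hence "((\<lambda>t. F (circlepath 0 r t) / circlepath 0 r t ^ Suc k * (2 * pi * \<i> * circlepath 0 r t)) has_integral
      ((2 * pi * \<i>) / (fact k) * (deriv ^^ k) F 0)) {0..1}"
    unfolding has_contour_integral_def
  proof (rule has_integral_eq[rotated])
    fix t :: real assume t: "t \<in> {0..1}"
    have "vector_derivative (circlepath 0 r) (at t within {0..1}) = 2 * pi * \<i> * r * exp (2 * pi * \<i> * t)"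
      using vector_derivative_circlepath01[of t 0 r] t by simp
    also have "\<dots> = 2 * pi * \<i> * circlepath 0 r t" by (simp add: circlepath)
    finally show "F (circlepath 0 r t) / (circlepath 0 r t - 0) ^ Suc k * vector_derivative (circlepath 0 r) (at t within {0..1})
        = F (circlepath 0 r t) / circlepath 0 r t ^ Suc k * (2 * pi * \<i> * circlepath 0 r t)"
      by simp
  qed
  hence "((\<lambda>t. 1 / (2 * pi * \<i>) * (F (circlepath 0 r t) / circlepath 0 r t ^ Suc k * (2 * pi * \<i> * circlepath 0 r t))) has_integral
      (1 / (2 * pi * \<i>) * ((2 * pi * \<i>) / (fact k) * (deriv ^^ k) F 0))) {0..1}"
    by (rule has_integral_mult_right)
  moreover have "circlepath 0 r t \<noteq> 0" for t using r by (simp add: circlepath)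
  ultimately show ?thesis by (simp add: field_simps)
qed

text \<open>Otherwise \<open>p\<close> is a nonzero constant, or its modulus tends to infinity with
  its argument.\<close>

lemma poly_tendsto_0_imp_0:
  fixes p :: "complex poly"
  assumes lim: "((\<lambda>y. poly p (f y)) \<longlongrightarrow> 0) at_top" and f: "filterlim f at_infinity (at_top :: real filter)"
  shows "p = 0"
proof (rule ccontr)
  assume "p \<noteq> 0"
  then obtain a q where p: "p = pCons a q" by (cases p) auto
  show False
  proof (cases "q = 0")
    case True
    with lim p \<open>p \<noteq> 0\<close> show False by (simp add: tendsto_const_iff)
  next
    case False
    from poly_infinity[OF False, of 1 a] obtain r where r: "\<And>z. r \<le> norm z \<Longrightarrow> 1 \<le> norm (poly p z)"
      using p by blast
    have "\<forall>\<^sub>F y in at_top. max r 1 \<le> norm (f y)"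
      using f[unfolded filterlim_at_infinity[OF order_refl]] by (metis less_max_iff_disj zero_less_one)
    hence "\<forall>\<^sub>F y in at_top. r \<le> norm (f y)" by eventually_elim simp
    moreover have "\<forall>\<^sub>F y in at_top. norm (poly p (f y)) < 1"
      using tendstoD[OF lim, of 1] by simp
    ultimately have "\<forall>\<^sub>F y in (at_top :: real filter). False"
      by eventually_elim (use r in fastforce)
    thus False by simp
  qed
qed

text \<open>On \<open>\<bar>z\<bar> = r\<close> the factor \<open>W = (z\<^sup>2 - r\<^sup>2) ^ M\<close> has modulus \<open>(2 r \<bar>Im z\<bar>) ^ M\<close>, which
  absorbs the singularity of the bound at the real points. As \<open>cnj z = r\<^sup>2 / z\<close> there,
  \<open>cnj F \<cdot> W / z ^ k\<close> is conjugate to a holomorphic function vanishing at \<open>0\<close>, so only \<open>F\<close> contributes.\<close>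

lemma entire_imaginary_growth_coefficient:
  assumes F: "F holomorphic_on UNIV"
    and R: "0 < R" and growth: "\<And>z. R \<le> norm z \<Longrightarrow> \<bar>Im (F z)\<bar> * \<bar>Im z\<bar> ^ M \<le> C * norm z ^ (2 * M)"
    and m: "M < m"
  shows "(deriv ^^ m) F 0 = 0"
proof -
  \<comment> \<open>The exponent \<open>k\<close> is tuned so that the term \<open>l = M\<close> in
    the expansion of \<open>W / z ^ k\<close> picks out \<open>c m\<close>. The average of
    \<open>F * W / z ^ k\<close> over radius \<open>r\<close> is then \<open>p\<close> at
    \<open>r^2\<close>, with constant term \<open>c m\<close>; it tends to 0 as \<open>r\<close>
    grows, so \<open>p = 0\<close>.\<close>
  define k where "k = 2 * M + m"
  define c where "c j = (deriv ^^ j) F 0 / fact j" for j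
  define cf where "cf l = of_nat (M choose l) * (-1) ^ (M - l) * c (k - 2 * l)" for l
  define p where "p = (\<Sum>l\<le>M. monom (cf l) (M - l))"
  have C: "0 \<le> C"
  proof -
    have "0 \<le> \<bar>Im (F R)\<bar> * \<bar>Im (of_real R)\<bar> ^ M" by simp
    also have "\<dots> \<le> C * R ^ (2 * M)" using growth[of "of_real R"] R by simp
    finally have "0 \<le> C * R ^ (2 * M)" .
    moreover have "0 < R ^ (2 * M)" using R by simp
    ultimately show ?thesis by (metis not_le mult_neg_pos)
  qed
  \<comment> \<open>\<open>F - cnj F\<close> contributes a factor 2, \<open>W\<close> together with
    the growth bound \<open>(2 * r) ^ M * C * r ^ (2 * M)\<close>; division by \<open>r ^ k\<close>
    leaves the order \<open>r ^ (M - m)\<close>, which decays since \<open>M < m\<close>.\<close>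
  have bound: "norm (poly p (of_real (r\<^sup>2))) \<le> 2 ^ (M + 1) * C * r ^ M / r ^ m" if r: "R \<le> r" for r
  proof -
    have r0: "0 < r" using R r by simp
    define z where "z = circlepath 0 r"
    have z0: "z t \<noteq> 0" for t using r0 by (simp add: z_def circlepath)
    have nz: "norm (z t) = r" for t using r0 by (simp add: z_def circlepath norm_mult)
    have zz: "z t * cnj (z t) = of_real (r\<^sup>2)" for t
      using nz[of t] by (simp add: complex_norm_square[symmetric])
    define W where "W t = (z t ^ 2 - of_real (r\<^sup>2)) ^ M" for t
    have W: "W t = (\<Sum>l\<le>M. of_nat (M choose l) * (z t ^ 2) ^ l * (- of_real (r\<^sup>2)) ^ (M - l))" for t
      using binomial_ring[of "z t ^ 2" "- of_real (r\<^sup>2)" M] by (simp add: W_def)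
    have 1: "((\<lambda>t. F (z t) * W t / z t ^ k) has_integral poly p (of_real (r\<^sup>2))) {0..1}"
    proof -
      have "((\<lambda>t. \<Sum>l\<le>M. of_nat (M choose l) * (- of_real (r\<^sup>2)) ^ (M - l) * (F (z t) / z t ^ (k - 2 * l)))
         has_integral (\<Sum>l\<le>M. of_nat (M choose l) * (- of_real (r\<^sup>2)) ^ (M - l) * c (k - 2 * l))) {0..1}"
        unfolding z_def c_def
        by (intro has_integral_sum has_integral_mult_right entire_fourier_coefficient F r0) auto
      also have "(\<Sum>l\<le>M. of_nat (M choose l) * (- of_real (r\<^sup>2)) ^ (M - l) * c (k - 2 * l)) = poly p (of_real (r\<^sup>2))"
        unfolding p_def poly_sum poly_monom cf_def
        by (intro sum.cong refl) (simp add: power_minus[of "(complex_of_real r)\<^sup>2"])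
      finally show ?thesis
      proof (rule has_integral_eq[rotated])
        fix t
        have e: "F (z t) / z t ^ (k - 2 * l) = F (z t) * (z t ^ 2) ^ l / z t ^ k" if "l \<le> M" for l
        proof -
          have "z t ^ k = z t ^ (k - 2 * l) * (z t ^ 2) ^ l"
            using that by (simp add: k_def power_mult[symmetric] power_add[symmetric])
          thus ?thesis using z0[of t] by simp
        qed
        show "(\<Sum>l\<le>M. of_nat (M choose l) * (- of_real (r\<^sup>2)) ^ (M - l) * (F (z t) / z t ^ (k - 2 * l)))
            = F (z t) * W t / z t ^ k"
          unfolding W sum_distrib_left sum_divide_distrib
        proof (intro sum.cong refl)
          fix l assume "l \<in> {..M}"
          hence "l \<le> M" by simp
          show "of_nat (M choose l) * (- of_real (r\<^sup>2)) ^ (M - l) * (F (z t) / z t ^ (k - 2 * l))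
             = F (z t) * (of_nat (M choose l) * (z t ^ 2) ^ l * (- of_real (r\<^sup>2)) ^ (M - l)) / z t ^ k"
            unfolding e[OF \<open>l \<le> M\<close>] by (simp add: mult_ac)
        qed
      qed
    qed
    have 2: "((\<lambda>t. cnj (F (z t)) * W t / z t ^ k) has_integral 0) {0..1}"
    proof -
      \<comment> \<open>The factor \<open>u ^ m\<close> makes \<open>G\<close> vanish at 0, as
        \<open>m > M\<close> is positive. With \<open>v = cnj u\<close> and
        \<open>u * v = r^2\<close>, both \<open>u^2 - r^2\<close> and \<open>v^2 - r^2\<close> are
        multiples of \<open>u - v\<close>; comparing them gives the constant in front of
        \<open>cnj (G (z t))\<close>.\<close>
      define G where "G u = F u * (u ^ 2 - of_real (r\<^sup>2)) ^ M * u ^ m" for u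
      have "G holomorphic_on UNIV" unfolding G_def by (intro holomorphic_intros F)
      from entire_fourier_coefficient[OF this r0, of 0]
      have iG: "((\<lambda>t. G (z t)) has_integral 0) {0..1}" using m by (simp add: G_def z_def power_0_left)
      have "((\<lambda>t. cnj (G (z t))) has_integral cnj 0) {0..1}"
        using has_integral_linear[OF iG bounded_linear_cnj] by (simp add: o_def)
      hence "((\<lambda>t. (-1) ^ M / of_real (r\<^sup>2) ^ (M + m) * cnj (G (z t))) has_integral 0) {0..1}"
        using has_integral_mult_right[of _ "cnj 0" _ "(-1) ^ M / of_real (r\<^sup>2) ^ (M + m)"] by simp
      thus ?thesis
      proof (rule has_integral_eq[rotated])
        fix t
        define u v where "u = z t" and "v = cnj (z t)"
        have uv: "of_real (r\<^sup>2) = u * v" and u0: "u \<noteq> 0" "v \<noteq> 0" using zz z0 by (auto simp: u_def v_def)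
        have "v ^ 2 - u * v = -1 * v * (u - v)" "u ^ 2 - u * v = u * (u - v)"
          by (simp_all add: power2_eq_square algebra_simps)
        hence pw: "(v ^ 2 - u * v) ^ M = (-1) ^ M * v ^ M * (u - v) ^ M"
            "(u ^ 2 - u * v) ^ M = u ^ M * (u - v) ^ M"
          by (simp_all only: power_mult_distrib)
        have sgn: "(-1) ^ M * (-1) ^ M = (1::complex)" by (simp add: power_mult_distrib[symmetric])
        have "(-1) ^ M / (u * v) ^ (M + m) * (cnj (F u) * (v ^ 2 - u * v) ^ M * v ^ m)
            = ((-1) ^ M * (-1) ^ M) * (cnj (F u) * (u - v) ^ M * (v ^ (M + m) / (u * v) ^ (M + m)))"
          unfolding pw power_add by simp
        also have "v ^ (M + m) / (u * v) ^ (M + m) = u ^ M / u ^ k"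
          using u0 by (simp add: k_def power_add power_mult_distrib mult_2 divide_simps)
        finally have "(-1) ^ M / (u * v) ^ (M + m) * (cnj (F u) * (v ^ 2 - u * v) ^ M * v ^ m)
            = cnj (F u) * (u ^ 2 - u * v) ^ M / u ^ k"
          unfolding pw sgn by (simp add: mult_ac)
        moreover have "cnj (G u) = cnj (F u) * (v ^ 2 - of_real (r\<^sup>2)) ^ M * v ^ m"
          by (simp add: G_def u_def v_def)
        ultimately show "(-1) ^ M / of_real (r\<^sup>2) ^ (M + m) * cnj (G (z t)) = cnj (F (z t)) * W t / z t ^ k"
          unfolding W_def u_def[symmetric] uv by simp
      qed
    qed
    have "norm (poly p (of_real (r\<^sup>2)) - 0) \<le> 2 ^ (M + 1) * C * r ^ M / r ^ m * measure lborel (cbox 0 (1::real))"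
    proof (rule has_integral_bound)
      show "((\<lambda>t. F (z t) * W t / z t ^ k - cnj (F (z t)) * W t / z t ^ k) has_integral (poly p (of_real (r\<^sup>2)) - 0)) (cbox 0 1)"
        unfolding cbox_interval by (rule has_integral_diff[OF 1 2])
      show "0 \<le> 2 ^ (M + 1) * C * r ^ M / r ^ m" using C r0 by simp
      fix t
      have "F (z t) * W t / z t ^ k - cnj (F (z t)) * W t / z t ^ k = 2 * \<i> * of_real (Im (F (z t))) * W t / z t ^ k"
        by (simp add: diff_divide_distrib[symmetric] left_diff_distrib[symmetric] complex_diff_cnj)
      moreover have "norm (W t) = (2 * r * \<bar>Im (z t)\<bar>) ^ M"
      proof -
        have "z t ^ 2 - of_real (r\<^sup>2) = z t * (z t - cnj (z t))"
          using zz[of t] by (simp add: power2_eq_square algebra_simps)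
        hence "norm (z t ^ 2 - of_real (r\<^sup>2)) = 2 * r * \<bar>Im (z t)\<bar>"
          by (simp add: norm_mult nz complex_diff_cnj)
        thus ?thesis by (simp add: W_def norm_power)
      qed
      ultimately have "norm (F (z t) * W t / z t ^ k - cnj (F (z t)) * W t / z t ^ k)
          = 2 ^ (M + 1) * r ^ M * (\<bar>Im (F (z t))\<bar> * \<bar>Im (z t)\<bar> ^ M) / r ^ k"
        by (simp add: norm_mult norm_divide norm_power nz power_mult_distrib mult_ac)
      also have "\<dots> \<le> 2 ^ (M + 1) * r ^ M * (C * r ^ (2 * M)) / r ^ k"
        using growth[of "z t"] r r0 by (intro divide_right_mono mult_left_mono) (auto simp: nz)
      also have "\<dots> = 2 ^ (M + 1) * C * r ^ M / r ^ m"
        using r0 by (simp add: k_def power_add field_simps)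
      finally show "norm (F (z t) * W t / z t ^ k - cnj (F (z t)) * W t / z t ^ k) \<le> 2 ^ (M + 1) * C * r ^ M / r ^ m" .
    qed
    thus ?thesis by simp
  qed
  have "p = 0"
  proof (rule poly_tendsto_0_imp_0)
    show "filterlim (\<lambda>r. complex_of_real (r\<^sup>2)) at_infinity (at_top :: real filter)"
      by (rule filterlim_compose[OF filterlim_of_real_at_infinity])
         (auto intro!: filterlim_pow_at_top filterlim_ident)
    have "((\<lambda>r. 2 ^ (M + 1) * C * inverse (r ^ (m - M))) \<longlongrightarrow> 2 ^ (M + 1) * C * 0) (at_top :: real filter)"
      using m by (intro tendsto_intros tendsto_inverse_0_at_top filterlim_pow_at_top filterlim_ident) auto
    hence "((\<lambda>r. 2 ^ (M + 1) * C * inverse (r ^ (m - M))) \<longlongrightarrow> 0) (at_top :: real filter)" by simp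
    hence lim: "((\<lambda>r. 2 ^ (M + 1) * C * r ^ M / r ^ m) \<longlongrightarrow> 0) (at_top :: real filter)"
    proof (rule Lim_transform_eventually)
      show "\<forall>\<^sub>F r in at_top. 2 ^ (M + 1) * C * inverse (r ^ (m - M)) = 2 ^ (M + 1) * C * r ^ M / (r::real) ^ m"
        using eventually_gt_at_top[of 0]
        by eventually_elim (use m in \<open>simp add: power_diff field_simps\<close>)
    qed
    show "((\<lambda>r. poly p (complex_of_real (r\<^sup>2))) \<longlongrightarrow> 0) at_top"
      by (rule Lim_null_comparison[OF _ lim])
         (rule eventually_mono[OF eventually_ge_at_top[of R] bound])
  qed
  hence "coeff p 0 = 0" by simp
  also have "coeff p 0 = (\<Sum>l\<le>M. if l = M then cf l else 0)"
    unfolding p_def coeff_sum by (intro sum.cong refl) auto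
  also have "\<dots> = cf M" by simp
  finally show ?thesis by (simp add: cf_def c_def k_def)
qed

section \<open>Polynomials: primitives, uniqueness and reflections\<close>

lemma poly_antiderivative:
  fixes p :: "'a :: field_char_0 poly"
  obtains q where "pderiv q = p"
proof -
  have "pderiv (\<Sum>i\<le>degree p. monom (coeff p i / of_nat (Suc i)) (Suc i)) = p"
    by (intro poly_eqI) (auto simp: coeff_pderiv coeff_sum coeff_eq_0 simp del: of_nat_Suc)
  thus ?thesis by (rule that)
qed

lemma higher_deriv_zero_imp_poly:
  assumes "f holomorphic_on S" "open S" "convex S" "\<And>z. z \<in> S \<Longrightarrow> (deriv ^^ n) f z = 0"
  shows "\<exists>p. \<forall>z\<in>S. f z = poly p z"
  using assms(1,4)
proof (induction n arbitrary: f)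
  case 0
  thus ?case by (intro exI[of _ 0]) auto
next
  case (Suc n)
  have "(deriv ^^ n) (deriv f) z = 0" if "z \<in> S" for z
    using Suc.prems(2)[OF that] by (simp add: funpow_swap1)
  from Suc.IH[OF holomorphic_deriv[OF Suc.prems(1) assms(2)] this]
  obtain p where p: "\<And>z. z \<in> S \<Longrightarrow> deriv f z = poly p z" by blast
  obtain q where q: "pderiv q = p" by (rule poly_antiderivative)
  have "\<exists>c. \<forall>z\<in>S. f z - poly q z = c"
  proof (rule has_field_derivative_zero_constant[OF assms(3)])
    fix z assume z: "z \<in> S"
    have "((\<lambda>z. f z - poly q z) has_field_derivative deriv f z - poly (pderiv q) z) (at z)"
      by (intro DERIV_diff poly_DERIV holomorphic_derivI[OF Suc.prems(1) assms(2) z])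
    thus "((\<lambda>z. f z - poly q z) has_field_derivative 0) (at z within S)"
      using p[OF z] by (simp add: q has_field_derivative_at_within)
  qed
  then obtain c where "\<And>z. z \<in> S \<Longrightarrow> f z = poly (q + [:c:]) z" by (auto simp: algebra_simps)
  thus ?case by blast
qed

lemma poly_eq_if_eq_on_reals:
  fixes p q :: "complex poly"
  assumes "\<And>x::real. poly p (of_real x) = poly q (of_real x)"
  shows "p = q"
proof (rule ccontr)
  assume "p \<noteq> q"
  hence "finite {z. poly (p - q) z = 0}" by (intro poly_roots_finite) simp
  moreover have "range complex_of_real \<subseteq> {z. poly (p - q) z = 0}" using assms by auto
  moreover have "infinite (range complex_of_real)"
    by (simp add: finite_image_iff inj_of_real infinite_UNIV_char_0)
  ultimately show False using finite_subset by blast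
qed

text \<open>For real coefficients \<open>p (x - \<i> * y)\<close> is conjugate to
  \<open>p (x + \<i> * y)\<close>, so twice the odd part of \<open>p\<close> about \<open>x\<close>
  takes the value \<open>2 * \<i> * Im (p (x + \<i> * y))\<close> at \<open>\<i> * y\<close>.
  Vanishing at 0, it has a polynomial quotient by its argument, and the ray condition sends this
  quotient to 0 along the imaginary axis.\<close>

lemma poly_reflection_of_ray:
  fixes p :: "complex poly"
  assumes real: "\<And>x::real. Im (poly p (of_real x)) = 0"
    and ray: "((\<lambda>y. Im (poly p (Complex x y)) / y) \<longlongrightarrow> 0) at_top"
  shows "poly p (2 * of_real x - z) = poly p z"
proof -
  have "map_poly cnj p = p"
  proof (rule poly_eq_if_eq_on_reals)
    fix x :: real
    have "poly (map_poly cnj p) (of_real x) = cnj (poly p (of_real x))" by (metis poly_cnj complex_cnj_complex_of_real)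
    also have "\<dots> = poly p (of_real x)" using real[of x] by (intro complex_eqI) simp_all
    finally show "poly (map_poly cnj p) (of_real x) = poly p (of_real x)" .
  qed
  hence cnj: "poly p (cnj z) = cnj (poly p z)" for z by (metis poly_cnj)
  define q where "q = pcompose p [:of_real x, 1:] - pcompose p [:of_real x, -1:]"
  have q: "poly q w = poly p (of_real x + w) - poly p (of_real x - w)" for w
    by (simp add: q_def poly_pcompose)
  have "poly q 0 = 0" by (simp add: q)
  hence "[:0, 1:] dvd q" using poly_eq_0_iff_dvd[of q 0] by simp
  then obtain s where s: "q = [:0, 1:] * s" by (rule dvdE)
  have "s = 0"
  proof (rule poly_tendsto_0_imp_0)
    show "filterlim (\<lambda>y. \<i> * complex_of_real y) at_infinity at_top"
      by (intro tendsto_mult_filterlim_at_infinity[of _ \<i>] tendsto_const filterlim_of_real_at_infinity) auto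
    have "((\<lambda>y. of_real (2 * (Im (poly p (Complex x y)) / y))) \<longlongrightarrow> complex_of_real (2 * 0)) at_top"
      by (intro tendsto_of_real tendsto_mult tendsto_const ray)
    hence "((\<lambda>y. of_real (2 * (Im (poly p (Complex x y)) / y))) \<longlongrightarrow> (0::complex)) at_top" by simp
    thus "((\<lambda>y. poly s (\<i> * complex_of_real y)) \<longlongrightarrow> 0) at_top"
    proof (rule Lim_transform_eventually)
      show "\<forall>\<^sub>F y in at_top. of_real (2 * (Im (poly p (Complex x y)) / y)) = poly s (\<i> * complex_of_real y)"
        using eventually_gt_at_top[of 0]
      proof eventually_elim
        case (elim y)
        have "\<i> * of_real y * poly s (\<i> * of_real y) = poly q (\<i> * of_real y)" by (simp add: s)
        also have "\<dots> = poly p (Complex x y) - poly p (cnj (Complex x y))"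
          by (simp add: q Complex_eq)
        also have "\<dots> = 2 * \<i> * of_real (Im (poly p (Complex x y)))"
          by (simp add: cnj complex_diff_cnj)
        finally show ?case using elim by (simp add: field_simps)
      qed
    qed
  qed
  hence "poly q (z - of_real x) = 0" by (simp add: s)
  thus ?thesis by (simp add: q algebra_simps)
qed

lemma poly_imaginary_part_zero:
  fixes p :: "complex poly"
  assumes real: "\<And>x::real. Im (poly p (of_real x)) = 0" and "x1 \<noteq> x2"
    and ray1: "((\<lambda>y. Im (poly p (Complex x1 y)) / y) \<longlongrightarrow> 0) at_top"
    and ray2: "((\<lambda>y. Im (poly p (Complex x2 y)) / y) \<longlongrightarrow> 0) at_top"
  shows "Im (poly p z) = 0"
proof -
  \<comment> \<open>Reflecting about \<open>x1\<close> and then about \<open>x2\<close> is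
    translation by \<open>2 * (x2 - x1)\<close>.\<close>
  define d where "d = 2 * complex_of_real (x2 - x1)"
  have per: "poly p (w + d) = poly p w" for w
    using poly_reflection_of_ray[OF real ray1, of w] poly_reflection_of_ray[OF real ray2, of "2 * of_real x1 - w"]
    by (simp add: d_def algebra_simps)
  have per': "poly p (of_nat n * d) = poly p 0" for n
  proof (induction n)
    case (Suc n)
    thus ?case using per[of "of_nat n * d"] by (simp add: algebra_simps)
  qed simp
  have "p - [:poly p 0:] = 0"
  proof (rule ccontr)
    assume "p - [:poly p 0:] \<noteq> 0"
    hence "finite {z. poly (p - [:poly p 0:]) z = 0}" by (rule poly_roots_finite)
    moreover have "range (\<lambda>n. of_nat n * d) \<subseteq> {z. poly (p - [:poly p 0:]) z = 0}" using per' by auto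
    moreover have "inj (\<lambda>n. of_nat n * d)" using assms(2) by (auto simp: inj_def d_def)
    ultimately show False using finite_subset finite_imageD by blast
  qed
  hence "poly (p - [:poly p 0:]) z = 0" by simp
  hence "poly p z = poly p 0" by simp
  thus ?thesis using real[of 0] by simp
qed

subsection \<open>Uniqueness for imaginary parts of holomorphic functions\<close>

text \<open>Translation by \<open>|t| <= a\<close> preserves \<open>Im z\<close>; for
  \<open>norm z >= R + a\<close> it stays outside radius \<open>R\<close> and at most doubles the
  norm. So the exponent \<open>M\<close> is kept, and only the constant depends on
  \<open>D\<close>.\<close>

lemma smear_growth:
  fixes w :: "complex \<Rightarrow> real"
  assumes w: "continuous_on uhp w" and D: "smooth_tower D a" and a: "0 < a" and R: "0 < R" and C: "0 \<le> C"
    and growth: "\<And>z. 0 < Im z \<Longrightarrow> R \<le> norm z \<Longrightarrow> \<bar>w z\<bar> * Im z ^ M \<le> C * norm z ^ (2 * M)"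
  shows "\<exists>C'. \<forall>z. 0 < Im z \<longrightarrow> R + a \<le> norm z \<longrightarrow> \<bar>smear w D a z\<bar> * Im z ^ M \<le> C' * norm z ^ (2 * M)"
proof -
  obtain K where K: "K > 0" "\<And>x. \<bar>D 0 x\<bar> \<le> K" using smooth_tower_bounded[OF D] by blast
  have "\<bar>smear w D a z\<bar> * Im z ^ M \<le> (C * 2 ^ (2 * M) * K * (a - -a)) * norm z ^ (2 * M)"
    if z: "0 < Im z" "R + a \<le> norm z" for z
  proof -
    have le: "\<bar>w (z + of_real t) * D 0 t\<bar> \<le> C * (2 * norm z) ^ (2 * M) / Im z ^ M * K"
      if t: "t \<in> {-a..a}" for t
    proof -
      have "norm z - a \<le> norm (z + of_real t)"
        using norm_triangle_ineq2[of z "- of_real t"] t by (auto simp: abs_le_iff)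
      hence 1: "R \<le> norm (z + of_real t)" using z by simp
      have "norm (z + of_real t) \<le> norm z + a"
        using norm_triangle_ineq[of z "of_real t"] t by (auto simp: abs_le_iff)
      hence 2: "norm (z + of_real t) \<le> 2 * norm z" using z R by simp
      have "\<bar>w (z + of_real t)\<bar> * Im z ^ M \<le> C * norm (z + of_real t) ^ (2 * M)"
        using growth[of "z + of_real t"] z 1 by simp
      also have "\<dots> \<le> C * (2 * norm z) ^ (2 * M)"
        by (intro mult_left_mono power_mono 2 C) auto
      finally have "\<bar>w (z + of_real t)\<bar> \<le> C * (2 * norm z) ^ (2 * M) / Im z ^ M"
        using z by (simp add: pos_le_divide_eq)
      thus ?thesis unfolding abs_mult by (rule mult_mono) (use C z K in auto)
    qed
    have "continuous_on {-a..a} (\<lambda>t. w (z + of_real t) * D 0 t)"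
      by (intro continuous_intros continuous_on_compose2[OF w] smooth_tower_continuous[OF D]) (use z in auto)
    hence "\<bar>smear w D a z\<bar> \<le> C * (2 * norm z) ^ (2 * M) / Im z ^ M * K * (a - -a)"
      unfolding smear_def real_norm_def[symmetric]
      by (rule integral_bound[rotated]) (use a le in auto)
    hence "\<bar>smear w D a z\<bar> * Im z ^ M \<le> C * (2 * norm z) ^ (2 * M) / Im z ^ M * K * (a - -a) * Im z ^ M"
      using z by (intro mult_right_mono) auto
    also have "\<dots> = (C * 2 ^ (2 * M) * K * (a - -a)) * norm z ^ (2 * M)"
      using z by (simp add: power_mult_distrib)
    finally show ?thesis .
  qed
  thus ?thesis by blast
qed

lemma entire_zero_if_higher_derivs_zero:
  assumes "F holomorphic_on UNIV" "\<And>n. (deriv ^^ n) F 0 = 0"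
  shows "F z = 0"
  by (rule holomorphic_fun_eq_0_on_ball[of F 0 "norm z + 1"])
     (use assms holomorphic_on_subset[OF assms(1)] in auto)

text \<open>The order \<open>Suc M\<close> is fixed by the growth of \<open>h\<close> alone, not by
  \<open>D\<close> or \<open>a\<close>.\<close>

lemma csmear_higher_deriv_zero:
  assumes h: "h holomorphic_on uhp" and D: "smooth_tower D a" and a: "0 < a"
    and bd: "\<And>D a. 0 < a \<Longrightarrow> smooth_tower D a \<Longrightarrow>
      ((\<lambda>y. smear (\<lambda>z. Im (h z)) D a (Complex 0 y)) \<longlongrightarrow> 0) (at_right 0)"
    and R: "0 < R" and C: "0 \<le> C"
    and growth: "\<And>z. 0 < Im z \<Longrightarrow> R \<le> norm z \<Longrightarrow> \<bar>Im (h z)\<bar> * Im z ^ M \<le> C * norm z ^ (2 * M)"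
    and z: "z \<in> uhp"
  shows "csmear ((deriv ^^ Suc M) h) D a z = 0"
proof -
  have op: "open uhp" by (rule open_halfspace_Im_gt)
  have ch: "continuous_on uhp h" by (rule holomorphic_on_imp_continuous_on[OF h])
  hence cw: "continuous_on uhp (\<lambda>z. Im (h z))" by (intro continuous_intros)
  obtain F where F: "F holomorphic_on UNIV" "\<And>z. z \<in> uhp \<Longrightarrow> F z = csmear h D a z"
    and sym: "\<And>z. F (cnj z) = cnj (F z)"
    using csmear_extends_to_entire[OF h D a bd] by blast
  obtain C' where C': "\<And>z. 0 < Im z \<Longrightarrow> R + a \<le> norm z \<Longrightarrow>
      \<bar>smear (\<lambda>z. Im (h z)) D a z\<bar> * Im z ^ M \<le> C' * norm z ^ (2 * M)"
    using smear_growth[OF cw D a R C growth] by blast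
  \<comment> \<open>The absolute value keeps the right-hand side nonnegative, which settles the real
    axis, where \<open>Im F\<close> vanishes by symmetry.\<close>
  have up: "\<bar>Im (F z)\<bar> * \<bar>Im z\<bar> ^ M \<le> \<bar>C'\<bar> * norm z ^ (2 * M)" if z: "R + a \<le> norm z" "0 < Im z" for z
  proof -
    have "\<bar>Im (F z)\<bar> * \<bar>Im z\<bar> ^ M \<le> C' * norm z ^ (2 * M)"
      using C'[OF z(2,1)] z(2) by (simp add: F(2) csmear_Im[OF ch D])
    also have "\<dots> \<le> \<bar>C'\<bar> * norm z ^ (2 * M)" by (intro mult_right_mono) auto
    finally show ?thesis .
  qed
  have gr: "\<bar>Im (F z)\<bar> * \<bar>Im z\<bar> ^ M \<le> \<bar>C'\<bar> * norm z ^ (2 * M)" if z: "R + a \<le> norm z" for z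
  proof -
    consider "0 < Im z" | "Im z = 0" | "Im z < 0" by linarith
    thus ?thesis
    proof cases
      case 2
      hence "cnj z = z" by (simp add: complex_eq_iff)
      with sym[of z] have "Im (F z) = 0" by (simp add: complex_eq_iff)
      thus ?thesis by simp
    next
      case 3
      with up[of "cnj z"] z show ?thesis by (simp add: sym)
    qed (use up z in blast)
  qed
  \<comment> \<open>The derivatives of \<open>G\<close> at 0 are those of \<open>F\<close> of order
    greater than \<open>M\<close>.\<close>
  define G where "G = (deriv ^^ Suc M) F"
  have "G w = 0" for w
  proof (rule entire_zero_if_higher_derivs_zero[of G])
    show "G holomorphic_on UNIV" unfolding G_def by (intro holomorphic_higher_deriv F(1)) auto
    show "(deriv ^^ n) G 0 = 0" for n
    proof -
      have "(deriv ^^ n) G 0 = (deriv ^^ (n + Suc M)) F 0"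
        by (simp only: G_def funpow_add o_apply)
      also have "\<dots> = 0"
        by (rule entire_imaginary_growth_coefficient[OF F(1) _ gr]) (use R a in auto)
      finally show ?thesis .
    qed
  qed
  moreover have "(deriv ^^ Suc M) (csmear h D a) z = (deriv ^^ Suc M) F z"
    by (rule higher_deriv_transform_within_open[OF _ _ op z])
       (use csmear_has_field_derivative[OF h D] op F holomorphic_on_subset in \<open>auto simp: holomorphic_on_open\<close>)
  ultimately show ?thesis
    using higher_deriv_csmear[OF h D z, of "Suc M"] by (simp add: G_def)
qed

lemma holomorphic_imaginary_part_uniqueness:
  assumes h: "h holomorphic_on uhp"
    and bd: "\<And>D a. 0 < a \<Longrightarrow> smooth_tower D a \<Longrightarrow>
      ((\<lambda>y. smear (\<lambda>z. Im (h z)) D a (Complex 0 y)) \<longlongrightarrow> 0) (at_right 0)"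
    and R: "0 < R" and C: "0 \<le> C"
    and growth: "\<And>z. 0 < Im z \<Longrightarrow> R \<le> norm z \<Longrightarrow> \<bar>Im (h z)\<bar> * Im z ^ M \<le> C * norm z ^ (2 * M)"
    and "x1 \<noteq> x2"
    and ray1: "((\<lambda>y. Im (h (Complex x1 y)) / y) \<longlongrightarrow> 0) at_top"
    and ray2: "((\<lambda>y. Im (h (Complex x2 y)) / y) \<longlongrightarrow> 0) at_top"
    and z: "z \<in> uhp"
  shows "Im (h z) = 0"
proof -
  have op: "open uhp" by (rule open_halfspace_Im_gt)
  \<comment> \<open>The order being common to all test functions, \<open>k\<close> on each
    horizontal line is orthogonal to every one of them.\<close>
  define k where "k = (deriv ^^ Suc M) h"
  have ck: "continuous_on uhp k"
    unfolding k_def by (intro holomorphic_on_imp_continuous_on holomorphic_higher_deriv h op)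
  have "k z = 0" if z: "z \<in> uhp" for z
  proof -
    have cz: "continuous_on UNIV (\<lambda>t. k (z + of_real t))"
      by (intro continuous_on_compose2[OF ck] continuous_intros) (use z in auto)
    have int: "((\<lambda>t. k (z + of_real t) * of_real (D 0 t)) has_integral 0) {-a..a}"
      if "0 < a" "smooth_tower D a" for D a
    proof -
      have "(\<lambda>t. k (z + of_real t) * of_real (D 0 t)) integrable_on {-a..a}"
        by (intro integrable_continuous_real continuous_on_csmear_integrand[OF ck that(2) z])
      moreover have "integral {-a..a} (\<lambda>t. k (z + of_real t) * of_real (D 0 t)) = 0"
        using csmear_higher_deriv_zero[OF h that(2,1) bd R C growth z] by (simp add: csmear_def k_def)
      ultimately show ?thesis by (simp add: has_integral_integrable_integral)
    qed
    have "Re (k (z + of_real 0)) = 0"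
    proof (rule zero_if_orthogonal_to_smooth_towers[where w = "\<lambda>t. Re (k (z + of_real t))"])
      show "continuous_on UNIV (\<lambda>t. Re (k (z + of_real t)))" by (intro continuous_intros cz)
      show "integral {-a..a} (\<lambda>t. Re (k (z + of_real t)) * D 0 t) = 0" if "0 < a" "smooth_tower D a" for D a
        using has_integral_linear[OF int[OF that] bounded_linear_Re] by (simp add: o_def integral_unique)
    qed
    moreover have "Im (k (z + of_real 0)) = 0"
    proof (rule zero_if_orthogonal_to_smooth_towers[where w = "\<lambda>t. Im (k (z + of_real t))"])
      show "continuous_on UNIV (\<lambda>t. Im (k (z + of_real t)))" by (intro continuous_intros cz)
      show "integral {-a..a} (\<lambda>t. Im (k (z + of_real t)) * D 0 t) = 0" if "0 < a" "smooth_tower D a" for D a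
        using has_integral_linear[OF int[OF that] bounded_linear_Im] by (simp add: o_def integral_unique)
    qed
    ultimately show ?thesis by (simp add: complex_eq_iff)
  qed
  then obtain p where p: "\<And>z. z \<in> uhp \<Longrightarrow> h z = poly p z"
    using higher_deriv_zero_imp_poly[OF h op convex_halfspace_Im_gt, of "Suc M"] unfolding k_def by blast
  have real: "Im (poly p (of_real x)) = 0" for x :: real
  proof (rule zero_if_orthogonal_to_smooth_towers[where w = "\<lambda>t. Im (poly p (of_real t))"])
    show "continuous_on UNIV (\<lambda>t. Im (poly p (of_real t)))" by (intro continuous_intros)
    fix D a assume a: "0 < a" and D: "smooth_tower D a"
    \<comment> \<open>\<open>J\<close> is continuous through 0 because \<open>p\<close> is a
      polynomial, and for positive \<open>y\<close> it is the smear of \<open>Im h\<close>, which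
      tends to 0. So the real slice of \<open>Im p\<close> is itself orthogonal to the test
      function.\<close>
    define J where "J y = integral {-a..a} (\<lambda>t. Im (poly p (Complex 0 y + of_real t)) * D 0 t)" for y
    have "continuous_on (UNIV \<times> cbox (-a) a) (\<lambda>(y, t). Im (poly p (Complex 0 y + of_real t)) * D 0 t)"
      unfolding split_beta Complex_eq
      by (intro continuous_intros continuous_on_compose2[OF smooth_tower_continuous[OF D, of UNIV]]) auto
    hence "continuous_on UNIV (\<lambda>y. integral (cbox (-a) a) (\<lambda>t. Im (poly p (Complex 0 y + of_real t)) * D 0 t))"
      by (rule integral_continuous_on_param)
    hence "isCont J 0" unfolding J_def[abs_def] by (simp add: continuous_on_eq_continuous_at)
    hence "(J \<longlongrightarrow> J 0) (at_right 0)" by (simp add: isCont_def filterlim_at_split)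
    moreover have "(J \<longlongrightarrow> 0) (at_right 0)"
    proof (rule Lim_transform_eventually[OF bd[OF a D]])
      show "\<forall>\<^sub>F y in at_right 0. smear (\<lambda>z. Im (h z)) D a (Complex 0 y) = J y"
        unfolding eventually_at_filter by (intro always_eventually) (auto simp: smear_def J_def p)
    qed
    ultimately have "J 0 = 0" using tendsto_unique trivial_limit_at_right_real by blast
    thus "integral {-a..a} (\<lambda>t. Im (poly p (of_real t)) * D 0 t) = 0"
      by (simp add: J_def Complex_eq)
  qed
  have ray: "((\<lambda>y. Im (poly p (Complex x y)) / y) \<longlongrightarrow> 0) at_top"
    if "((\<lambda>y. Im (h (Complex x y)) / y) \<longlongrightarrow> 0) at_top" for x
    by (rule Lim_transform_eventually[OF that])
       (use eventually_gt_at_top[of 0] in eventually_elim, simp add: p)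
  from poly_imaginary_part_zero[OF real \<open>x1 \<noteq> x2\<close> ray[OF ray1] ray[OF ray2], of z] p[OF z]
  show ?thesis by simp
qed

subsection \<open>Harmonic functions as imaginary parts\<close>

text \<open>Clairaut's theorem: by the mean value theorem in either order of the variables, the
  second difference \<open>\<Delta>\<close> over a small square is \<open>d^2\<close> times either
  mixed derivative at some point of the square.\<close>

lemma mixed_partials_symmetric:
  fixes u ux uy uxy uyx :: "real \<Rightarrow> real \<Rightarrow> real"
  assumes S: "open S" and z: "Complex x0 y0 \<in> S"
    and ux: "\<And>x y. Complex x y \<in> S \<Longrightarrow> ((\<lambda>x. u x y) has_real_derivative ux x y) (at x)"
    and uy: "\<And>x y. Complex x y \<in> S \<Longrightarrow> ((\<lambda>y. u x y) has_real_derivative uy x y) (at y)"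
    and uxy: "\<And>x y. Complex x y \<in> S \<Longrightarrow> ((\<lambda>y. ux x y) has_real_derivative uxy x y) (at y)"
    and uyx: "\<And>x y. Complex x y \<in> S \<Longrightarrow> ((\<lambda>x. uy x y) has_real_derivative uyx x y) (at x)"
    and c1: "continuous_on S (\<lambda>z. uxy (Re z) (Im z))" and c2: "continuous_on S (\<lambda>z. uyx (Re z) (Im z))"
  shows "uxy x0 y0 = uyx x0 y0"
proof (rule ccontr)
  assume neq: "uxy x0 y0 \<noteq> uyx x0 y0"
  define e where "e = \<bar>uxy x0 y0 - uyx x0 y0\<bar> / 2"
  have e: "0 < e" using neq by (simp add: e_def)
  obtain d0 where d0: "d0 > 0" "ball (Complex x0 y0) d0 \<subseteq> S" using S z open_contains_ball by blast
  obtain d1 where d1: "d1 > 0" "\<And>w. w \<in> S \<Longrightarrow> dist w (Complex x0 y0) < d1 \<Longrightarrow> dist (uxy (Re w) (Im w)) (uxy x0 y0) < e"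
    using c1 z e unfolding continuous_on_iff by (metis complex.sel)
  obtain d2 where d2: "d2 > 0" "\<And>w. w \<in> S \<Longrightarrow> dist w (Complex x0 y0) < d2 \<Longrightarrow> dist (uyx (Re w) (Im w)) (uyx x0 y0) < e"
    using c2 z e unfolding continuous_on_iff by (metis complex.sel)
  \<comment> \<open>The 3 leaves room: points of the square lie within \<open>2 * d < 3 * d\<close>
    of its corner.\<close>
  define d where "d = min d0 (min d1 d2) / 3"
  have d: "0 < d" "d * 3 \<le> d0" "d * 3 \<le> d1" "d * 3 \<le> d2" using d0 d1 d2 by (auto simp: d_def)
  have near: "dist (Complex x y) (Complex x0 y0) < 3 * d" if "x0 \<le> x" "x \<le> x0 + d" "y0 \<le> y" "y \<le> y0 + d" for x y
  proof -
    have "dist (Complex x y) (Complex x0 y0) \<le> \<bar>x - x0\<bar> + \<bar>y - y0\<bar>"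
      using cmod_le[of "Complex x y - Complex x0 y0"] by (simp add: dist_norm)
    also have "\<dots> < 3 * d" using that d(1) by simp
    finally show ?thesis .
  qed
  have inS: "Complex x y \<in> S" if "x0 \<le> x" "x \<le> x0 + d" "y0 \<le> y" "y \<le> y0 + d" for x y
    using near[OF that] d0(2) d(2) by (auto simp: dist_commute subset_iff)
  define \<Delta> where "\<Delta> = u (x0 + d) (y0 + d) - u (x0 + d) y0 - u x0 (y0 + d) + u x0 y0"
  have "\<exists>s t. x0 \<le> s \<and> s \<le> x0 + d \<and> y0 \<le> t \<and> t \<le> y0 + d \<and> \<Delta> = d * (d * uxy s t)"
  proof -
    have "\<exists>s. x0 < s \<and> s < x0 + d \<and> (u (x0 + d) (y0 + d) - u (x0 + d) y0) - (u x0 (y0 + d) - u x0 y0)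
        = (x0 + d - x0) * (ux s (y0 + d) - ux s y0)"
      by (rule MVT2) (use d inS in \<open>auto intro!: DERIV_diff ux\<close>)
    then obtain s where s: "x0 < s" "s < x0 + d" "\<Delta> = d * (ux s (y0 + d) - ux s y0)" by (auto simp: \<Delta>_def)
    have "\<exists>t. y0 < t \<and> t < y0 + d \<and> ux s (y0 + d) - ux s y0 = (y0 + d - y0) * uxy s t"
      by (rule MVT2) (use d inS s in \<open>auto intro!: uxy\<close>)
    then obtain t where "y0 < t" "t < y0 + d" "ux s (y0 + d) - ux s y0 = d * uxy s t" by auto
    with s show ?thesis by (intro exI[of _ s] exI[of _ t]) simp
  qed
  then obtain s t where st: "x0 \<le> s" "s \<le> x0 + d" "y0 \<le> t" "t \<le> y0 + d" "\<Delta> = d * (d * uxy s t)" by blast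
  have "\<exists>s t. x0 \<le> s \<and> s \<le> x0 + d \<and> y0 \<le> t \<and> t \<le> y0 + d \<and> \<Delta> = d * (d * uyx s t)"
  proof -
    have "\<exists>t. y0 < t \<and> t < y0 + d \<and> (u (x0 + d) (y0 + d) - u x0 (y0 + d)) - (u (x0 + d) y0 - u x0 y0)
        = (y0 + d - y0) * (uy (x0 + d) t - uy x0 t)"
      by (rule MVT2) (use d inS in \<open>auto intro!: DERIV_diff uy\<close>)
    then obtain t where t: "y0 < t" "t < y0 + d" "\<Delta> = d * (uy (x0 + d) t - uy x0 t)" by (auto simp: \<Delta>_def)
    have "\<exists>s. x0 < s \<and> s < x0 + d \<and> uy (x0 + d) t - uy x0 t = (x0 + d - x0) * uyx s t"
      by (rule MVT2) (use d inS t in \<open>auto intro!: uyx\<close>)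
    then obtain s where "x0 < s" "s < x0 + d" "uy (x0 + d) t - uy x0 t = d * uyx s t" by auto
    with t show ?thesis by (intro exI[of _ s] exI[of _ t]) simp
  qed
  then obtain s' t' where st': "x0 \<le> s'" "s' \<le> x0 + d" "y0 \<le> t'" "t' \<le> y0 + d" "\<Delta> = d * (d * uyx s' t')" by blast
  have "uxy s t = uyx s' t'" using st(5) st'(5) d(1) by simp
  moreover have "dist (uxy s t) (uxy x0 y0) < e"
    using d1(2)[OF inS[OF st(1-4)]] near[OF st(1-4)] d by simp
  moreover have "dist (uyx s' t') (uyx x0 y0) < e"
    using d2(2)[OF inS[OF st'(1-4)]] near[OF st'(1-4)] d by simp
  ultimately show False unfolding e_def dist_real_def by (simp add: field_simps abs_if split: if_splits)
qed

text \<open>Moving horizontally from \<open>z\<close>, then vertically to \<open>w\<close>, reduces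
  the increment to two one-variable mean value estimates, each costing \<open>e / 2\<close>.\<close>

lemma has_derivative_from_partials:
  fixes v vx vy :: "complex \<Rightarrow> real"
  assumes S: "open S" and z: "z \<in> S"
    and vx: "\<And>x y. Complex x y \<in> S \<Longrightarrow> ((\<lambda>x. v (Complex x y)) has_real_derivative vx (Complex x y)) (at x)"
    and vy: "\<And>x y. Complex x y \<in> S \<Longrightarrow> ((\<lambda>y. v (Complex x y)) has_real_derivative vy (Complex x y)) (at y)"
    and c1: "continuous_on S vx" and c2: "continuous_on S vy"
  shows "(v has_derivative (\<lambda>h. vx z * Re h + vy z * Im h)) (at z)"
  unfolding has_derivative_at_alt
proof (intro conjI allI impI)
  show "bounded_linear (\<lambda>h. vx z * Re h + vy z * Im h)"
    by (intro bounded_linear_add bounded_linear_const_mult bounded_linear_Re bounded_linear_Im)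
  fix e :: real assume e: "0 < e"
  obtain d0 where d0: "d0 > 0" "ball z d0 \<subseteq> S" using S z open_contains_ball by blast
  obtain d1 where d1: "d1 > 0" "\<And>w. w \<in> S \<Longrightarrow> dist w z < d1 \<Longrightarrow> dist (vx w) (vx z) < e / 2"
    using c1 z e unfolding continuous_on_iff by (metis half_gt_zero)
  obtain d2 where d2: "d2 > 0" "\<And>w. w \<in> S \<Longrightarrow> dist w z < d2 \<Longrightarrow> dist (vy w) (vy z) < e / 2"
    using c2 z e unfolding continuous_on_iff by (metis half_gt_zero)
  define d where "d = min d0 (min d1 d2)"
  have "norm (v w - v z - (vx z * Re (w - z) + vy z * Im (w - z))) \<le> e * norm (w - z)" if w: "norm (w - z) < d" for w
  proof -
    have near: "dist (Complex s t) z < d"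
      if "s \<in> closed_segment (Re z) (Re w)" "t \<in> closed_segment (Im z) (Im w)" for s t
    proof -
      have "\<bar>s - Re z\<bar> \<le> \<bar>Re w - Re z\<bar>" "\<bar>t - Im z\<bar> \<le> \<bar>Im w - Im z\<bar>"
        using that by (auto simp: closed_segment_eq_real_ivl split: if_splits)
      hence "norm (Complex s t - z) \<le> norm (w - z)"
        unfolding cmod_def by (intro real_sqrt_le_mono add_mono) (auto simp: abs_le_square_iff)
      thus ?thesis using w by (simp add: dist_norm)
    qed
    have inS: "Complex s t \<in> S"
      if "s \<in> closed_segment (Re z) (Re w)" "t \<in> closed_segment (Im z) (Im w)" for s t
      using near[OF that] d0(2) by (auto simp: d_def dist_commute subset_iff)
    have "norm ((v (Complex (Re w) (Im w)) - vy z * Im w) - (v (Complex (Re w) (Im z)) - vy z * Im z))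
        \<le> e / 2 * norm (Im w - Im z)"
    proof (rule field_differentiable_bound[where S = "closed_segment (Im z) (Im w)"])
      fix t assume t: "t \<in> closed_segment (Im z) (Im w)"
      show "((\<lambda>t. v (Complex (Re w) t) - vy z * t) has_real_derivative vy (Complex (Re w) t) - vy z)
          (at t within closed_segment (Im z) (Im w))"
        by (rule has_field_derivative_at_within)
           (auto intro!: derivative_eq_intros vy inS t)
      show "norm (vy (Complex (Re w) t) - vy z) \<le> e / 2"
        using d2(2)[OF inS[OF _ t]] near[OF _ t] by (fastforce simp: d_def dist_norm)
    qed auto
    moreover have "norm ((v (Complex (Re w) (Im z)) - vx z * Re w) - (v (Complex (Re z) (Im z)) - vx z * Re z))
        \<le> e / 2 * norm (Re w - Re z)"
    proof (rule field_differentiable_bound[where S = "closed_segment (Re z) (Re w)"])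
      fix t assume t: "t \<in> closed_segment (Re z) (Re w)"
      show "((\<lambda>t. v (Complex t (Im z)) - vx z * t) has_real_derivative vx (Complex t (Im z)) - vx z)
          (at t within closed_segment (Re z) (Re w))"
        by (rule has_field_derivative_at_within)
           (auto intro!: derivative_eq_intros vx inS t)
      show "norm (vx (Complex t (Im z)) - vx z) \<le> e / 2"
        using d1(2)[OF inS[OF t]] near[OF t] by (fastforce simp: d_def dist_norm)
    qed auto
    moreover have "e / 2 * norm (Im w - Im z) \<le> e / 2 * norm (w - z)" "e / 2 * norm (Re w - Re z) \<le> e / 2 * norm (w - z)"
      using e abs_Im_le_cmod[of "w - z"] abs_Re_le_cmod[of "w - z"] by (auto intro!: mult_left_mono)
    moreover have "v w - v z - (vx z * Re (w - z) + vy z * Im (w - z))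
       = ((v (Complex (Re w) (Im w)) - vy z * Im w) - (v (Complex (Re w) (Im z)) - vy z * Im z))
       + ((v (Complex (Re w) (Im z)) - vx z * Re w) - (v (Complex (Re z) (Im z)) - vx z * Re z))"
      by (simp add: algebra_simps)
    ultimately show ?thesis unfolding real_norm_def by linarith
  qed
  thus "\<exists>d>0. \<forall>w. norm (w - z) < d \<longrightarrow> norm (v w - v z - (vx z * Re (w - z) + vy z * Im (w - z))) \<le> e * norm (w - z)"
    using d0 d1 d2 by (intro exI[of _ d]) (auto simp: d_def)
qed

text \<open>A holomorphic \<open>h\<close> with imaginary part \<open>v\<close> must have derivative
  \<open>vy + \<i> * vx\<close>. The Laplace equation and the symmetry of mixed derivatives are the
  Cauchy--Riemann equations of this candidate, and convexity supplies its primitive.\<close>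

lemma harmonic_imp_imaginary_part:
  fixes v vx vy vxx vxy vyx vyy :: "complex \<Rightarrow> real"
  assumes S: "open S" "convex S"
    and vx: "\<And>x y. Complex x y \<in> S \<Longrightarrow> ((\<lambda>x. v (Complex x y)) has_real_derivative vx (Complex x y)) (at x)"
    and vy: "\<And>x y. Complex x y \<in> S \<Longrightarrow> ((\<lambda>y. v (Complex x y)) has_real_derivative vy (Complex x y)) (at y)"
    and vxx: "\<And>x y. Complex x y \<in> S \<Longrightarrow> ((\<lambda>x. vx (Complex x y)) has_real_derivative vxx (Complex x y)) (at x)"
    and vxy: "\<And>x y. Complex x y \<in> S \<Longrightarrow> ((\<lambda>y. vx (Complex x y)) has_real_derivative vxy (Complex x y)) (at y)"
    and vyx: "\<And>x y. Complex x y \<in> S \<Longrightarrow> ((\<lambda>x. vy (Complex x y)) has_real_derivative vyx (Complex x y)) (at x)"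
    and vyy: "\<And>x y. Complex x y \<in> S \<Longrightarrow> ((\<lambda>y. vy (Complex x y)) has_real_derivative vyy (Complex x y)) (at y)"
    and cont: "continuous_on S vx" "continuous_on S vy" "continuous_on S vxx" "continuous_on S vxy"
      "continuous_on S vyx" "continuous_on S vyy"
    and lap: "\<And>z. z \<in> S \<Longrightarrow> vxx z + vyy z = 0"
  shows "\<exists>h. h holomorphic_on S \<and> (\<forall>z\<in>S. v z = Im (h z))"
proof -
  have sym: "vxy z = vyx z" if "z \<in> S" for z
    using mixed_partials_symmetric[of S "Re z" "Im z" "\<lambda>x y. v (Complex x y)" "\<lambda>x y. vx (Complex x y)"
        "\<lambda>x y. vy (Complex x y)" "\<lambda>x y. vxy (Complex x y)" "\<lambda>x y. vyx (Complex x y)"]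
      S vx vy vxy vyx cont that by simp
  define f where "f z = of_real (vy z) + \<i> * of_real (vx z)" for z
  have df: "(f has_field_derivative (of_real (vyx z) + \<i> * of_real (vxx z))) (at z)" if z: "z \<in> S" for z
  proof -
    have 1: "(vy has_derivative (\<lambda>h. vyx z * Re h + vyy z * Im h)) (at z)"
      by (rule has_derivative_from_partials[OF S(1) z vyx vyy cont(5,6)])
    have 2: "(vx has_derivative (\<lambda>h. vxx z * Re h + vxy z * Im h)) (at z)"
      by (rule has_derivative_from_partials[OF S(1) z vxx vxy cont(3,4)])
    have "(f has_derivative (\<lambda>h. of_real (vyx z * Re h + vyy z * Im h) + \<i> * of_real (vxx z * Re h + vxy z * Im h))) (at z)"
      unfolding f_def[abs_def]
      by (intro has_derivative_add has_derivative_mult_right has_derivative_of_real 1 2)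
    moreover have "vyy z = - vxx z" using lap[OF z] by simp
    hence "(\<lambda>h. of_real (vyx z * Re h + vyy z * Im h) + \<i> * of_real (vxx z * Re h + vxy z * Im h))
        = (*) (of_real (vyx z) + \<i> * of_real (vxx z))"
      by (simp add: fun_eq_iff complex_eq_iff sym[OF z])
    ultimately show ?thesis by (simp only: has_field_derivative_def)
  qed
  hence "f holomorphic_on S" using S(1) by (auto simp: holomorphic_on_open)
  then obtain h1 where h1: "\<And>z. z \<in> S \<Longrightarrow> (h1 has_field_derivative f z) (at z within S)"
    using holomorphic_convex_primitive'[OF S(2,1)] by blast
  have "\<exists>c. \<forall>z\<in>S. v z - Im (h1 z) = c"
  proof (rule has_derivative_zero_constant[OF S(2)])
    fix z assume z: "z \<in> S"
    have "(v has_derivative (\<lambda>h. vx z * Re h + vy z * Im h)) (at z within S)"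
      by (rule has_derivative_at_withinI[OF has_derivative_from_partials[OF S(1) z vx vy cont(1,2)]])
    moreover have "((\<lambda>z. Im (h1 z)) has_derivative (\<lambda>h. Im (f z * h))) (at z within S)"
      using h1[OF z] by (intro has_derivative_Im) (simp add: has_field_derivative_def)
    ultimately have "((\<lambda>z. v z - Im (h1 z)) has_derivative (\<lambda>h. (vx z * Re h + vy z * Im h) - Im (f z * h))) (at z within S)"
      by (rule has_derivative_diff)
    thus "((\<lambda>z. v z - Im (h1 z)) has_derivative (\<lambda>h. 0)) (at z within S)"
      by (simp add: f_def algebra_simps)
  qed
  then obtain c where c: "\<And>z. z \<in> S \<Longrightarrow> v z - Im (h1 z) = c" by blast
  have "(\<lambda>z. h1 z + \<i> * of_real c) holomorphic_on S"
    using h1 by (intro holomorphic_intros) (auto simp: holomorphic_on_def field_differentiable_def)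
  moreover have "v z = Im (h1 z + \<i> * of_real c)" if "z \<in> S" for z using c[OF that] by simp
  ultimately show ?thesis by blast
qed

section \<open>From directional derivatives to real partial derivatives\<close>

lemma dir_deriv_partial:
  fixes g :: "complex \<Rightarrow> complex"
  assumes L: "bounded_linear L" and z: "(\<lambda>t::real. g (z + t *\<^sub>R v)) differentiable (at 0)"
  shows "((\<lambda>t. L (g (z + (t - s) *\<^sub>R v))) has_real_derivative L (dir_deriv v g z)) (at s)"
proof -
  have "((\<lambda>t. g (z + t *\<^sub>R v)) has_vector_derivative dir_deriv v g z) (at (s - s))"
    using z by (simp add: dir_deriv_def vector_derivative_works)
  moreover have "((\<lambda>t. t - s) has_vector_derivative 1) (at s)" by (auto intro!: derivative_eq_intros)
  ultimately have "((\<lambda>t. g (z + t *\<^sub>R v)) \<circ> (\<lambda>t. t - s) has_vector_derivative 1 *\<^sub>R dir_deriv v g z) (at s)"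
    by (intro vector_diff_chain_at)
  from bounded_linear.has_vector_derivative[OF L this] show ?thesis
    by (simp add: has_real_derivative_iff_has_vector_derivative o_def)
qed

lemma dir_deriv_partials:
  fixes g :: "complex \<Rightarrow> complex"
  assumes "bounded_linear L" "\<And>v. v \<in> Basis \<Longrightarrow> (\<lambda>t::real. g (Complex x y + t *\<^sub>R v)) differentiable (at 0)"
  shows "((\<lambda>x. L (g (Complex x y))) has_real_derivative L (dir_deriv 1 g (Complex x y))) (at x)"
    and "((\<lambda>y. L (g (Complex x y))) has_real_derivative L (dir_deriv \<i> g (Complex x y))) (at y)"
proof -
  have e: "Complex x y + (t - x) *\<^sub>R 1 = Complex t y" "Complex x y + (t - y) *\<^sub>R \<i> = Complex x t" for t
    by (simp_all add: complex_eq_iff)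
  show "((\<lambda>x. L (g (Complex x y))) has_real_derivative L (dir_deriv 1 g (Complex x y))) (at x)"
    using dir_deriv_partial[OF assms(1) assms(2)[of 1], of x] by (simp only: e) (simp add: Basis_complex_def)
  show "((\<lambda>y. L (g (Complex x y))) has_real_derivative L (dir_deriv \<i> g (Complex x y))) (at y)"
    using dir_deriv_partial[OF assms(1) assms(2)[of \<i>], of y] by (simp only: e) (simp add: Basis_complex_def)
qed

text \<open>\<open>L\<close> will be \<open>Re\<close> and \<open>Im\<close>, so one argument serves
  both components of \<open>u\<close>.\<close>

lemma harmonic_on_imp_imaginary_part:
  fixes u :: "complex \<Rightarrow> complex"
  assumes u: "harmonic_on S u" and S: "convex S" and L: "bounded_linear L"
  shows "\<exists>h. h holomorphic_on S \<and> (\<forall>z\<in>S. L (u z) = Im (h z))"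
proof -
  have S': "open S" and C2: "Ck_on (Suc (Suc 0)) S u" and lap: "\<And>z. z \<in> S \<Longrightarrow> laplacian u z = 0"
    using u by (auto simp: harmonic_on_def numeral_2_eq_2)
  have d1: "(\<lambda>t::real. u (z + t *\<^sub>R v)) differentiable (at 0)" if "v \<in> Basis" "z \<in> S" for v z
    using C2 that by simp
  have C1: "continuous_on S (dir_deriv v u)"
    and d2: "w \<in> Basis \<Longrightarrow> z \<in> S \<Longrightarrow> (\<lambda>t::real. dir_deriv v u (z + t *\<^sub>R w)) differentiable (at 0)"
    and C0: "w \<in> Basis \<Longrightarrow> continuous_on S (dir_deriv w (dir_deriv v u))" if "v \<in> Basis" for v w z
    using C2 that by auto
  have B: "(1::complex) \<in> Basis" "\<i> \<in> Basis" by (auto simp: Basis_complex_def)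
  have cL: "continuous_on S (\<lambda>z. L (g z))" if "continuous_on S g" for g :: "complex \<Rightarrow> complex"
    by (rule bounded_linear.continuous_on[OF L that])
  show ?thesis
  proof (rule harmonic_imp_imaginary_part[OF S' S])
    show "((\<lambda>x. L (u (Complex x y))) has_real_derivative L (dir_deriv 1 u (Complex x y))) (at x)"
      "((\<lambda>y. L (u (Complex x y))) has_real_derivative L (dir_deriv \<i> u (Complex x y))) (at y)"
      if "Complex x y \<in> S" for x y
      by (rule dir_deriv_partials[OF L d1]; use that in simp)+
    show "((\<lambda>x. L (dir_deriv 1 u (Complex x y))) has_real_derivative L (dir_deriv 1 (dir_deriv 1 u) (Complex x y))) (at x)"
      "((\<lambda>y. L (dir_deriv 1 u (Complex x y))) has_real_derivative L (dir_deriv \<i> (dir_deriv 1 u) (Complex x y))) (at y)"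
      "((\<lambda>x. L (dir_deriv \<i> u (Complex x y))) has_real_derivative L (dir_deriv 1 (dir_deriv \<i> u) (Complex x y))) (at x)"
      "((\<lambda>y. L (dir_deriv \<i> u (Complex x y))) has_real_derivative L (dir_deriv \<i> (dir_deriv \<i> u) (Complex x y))) (at y)"
      if "Complex x y \<in> S" for x y
      by (rule dir_deriv_partials[OF L d2]; use that B in simp)+
    show "L (dir_deriv 1 (dir_deriv 1 u) z) + L (dir_deriv \<i> (dir_deriv \<i> u) z) = 0" if "z \<in> S" for z
    proof -
      have "dir_deriv 1 (dir_deriv 1 u) z + dir_deriv \<i> (dir_deriv \<i> u) z = 0"
        using lap[OF that] by (simp add: laplacian_def Basis_complex_def)
      thus ?thesis by (metis L bounded_linear.linear linear_add linear_0)
    qed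
  qed (intro cL C1 C0 B)+
qed

subsection \<open>Uniqueness for harmonic functions\<close>

text \<open>As \<open>Im z <= norm z\<close>, the base \<open>(norm z)^2 / Im z\<close> is at least
  1 once \<open>norm z >= 1\<close>, so the real exponent may be rounded up. Radius
  \<open>R + 1\<close> ensures this and the strict inequality \<open>norm z > R\<close>.\<close>

lemma temperate_natural_exponent:
  assumes "temperate_at_infinity u"
  obtains R C M where "0 < R" "0 \<le> C"
    "\<And>z. 0 < Im z \<Longrightarrow> R \<le> norm z \<Longrightarrow> norm (u z) * Im z ^ M \<le> C * norm z ^ (2 * M)"
proof -
  obtain C R N where C: "0 < C" and R: "0 < R" and u: "\<And>z. 0 < Im z \<Longrightarrow> R < norm z \<Longrightarrow>
      norm (u z) \<le> C * ((norm z)\<^sup>2 / Im z) powr N"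
    using assms by (auto simp: temperate_at_infinity_def upper_halfplane_def)
  define M where "M = nat \<lceil>N\<rceil>"
  have "norm (u z) * Im z ^ M \<le> C * norm z ^ (2 * M)" if z: "0 < Im z" "R + 1 \<le> norm z" for z
  proof -
    have "Im z \<le> norm z" by (rule order_trans[OF abs_ge_self abs_Im_le_cmod])
    moreover have "norm z * 1 \<le> norm z * norm z" using z R by (intro mult_left_mono) auto
    ultimately have ge1: "1 \<le> (norm z)\<^sup>2 / Im z" using z by (simp add: power2_eq_square)
    have "norm (u z) \<le> C * ((norm z)\<^sup>2 / Im z) powr N" using u z by simp
    also have "\<dots> \<le> C * ((norm z)\<^sup>2 / Im z) powr real M"
      using ge1 C by (intro mult_left_mono powr_mono) (auto simp: M_def real_nat_ceiling_ge)
    also have "\<dots> = C * norm z ^ (2 * M) / Im z ^ M"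
      using ge1 by (subst powr_realpow) (auto simp: power_divide power_mult)
    finally show ?thesis using z by (simp add: pos_le_divide_eq)
  qed
  with that[of "R + 1" C M] C R show ?thesis by simp
qed

lemma boundary_limit_smear:
  fixes L :: "complex \<Rightarrow> real"
  assumes bd: "boundary_limit_zero u" and u: "continuous_on uhp u"
    and L: "bounded_linear L" and Lr: "\<And>z r. L (z * of_real r) = L z * r"
    and D: "smooth_tower D a"
  shows "((\<lambda>y. smear (\<lambda>z. L (u z)) D a (Complex 0 y)) \<longlongrightarrow> 0) (at_right 0)"
proof -
  have "((\<lambda>y. L (LINT x|lborel. u (Complex x y) * of_real (D 0 x))) \<longlongrightarrow> L 0) (at_right 0)"
    using bd test_function_smooth_tower[OF D]
    by (intro bounded_linear.tendsto[OF L]) (simp add: boundary_limit_zero_def)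
  hence "((\<lambda>y. L (LINT x|lborel. u (Complex x y) * of_real (D 0 x))) \<longlongrightarrow> 0) (at_right 0)"
    using linear_0[OF bounded_linear.linear[OF L]] by simp
  moreover have "L (LINT x|lborel. u (Complex x y) * of_real (D 0 x)) = smear (\<lambda>z. L (u z)) D a (Complex 0 y)"
    if y: "0 < y" for y
  proof -
    let ?f = "\<lambda>x. u (Complex x y) * of_real (D 0 x)"
    have cf: "continuous_on {-a..a} ?f"
      by (intro continuous_intros continuous_on_compose2[OF u] smooth_tower_continuous[OF D])
         (use y in \<open>auto simp: Complex_eq intro!: continuous_intros\<close>)
    have si: "set_integrable lborel {-a..a} ?f"
      by (rule borel_integrable_atLeastAtMost'[OF cf])
    have "(LINT x|lborel. ?f x) = (LINT x:{-a..a}|lborel. ?f x)"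
      unfolding set_lebesgue_integral_def
      by (rule Bochner_Integration.integral_cong[OF refl])
         (use smooth_tower_zero[OF D, of _ 0] in \<open>force simp: indicator_def abs_le_iff not_le\<close>)
    also have "\<dots> = integral {-a..a} ?f" by (rule set_borel_integral_eq_integral(2)[OF si])
    finally have "L (LINT x|lborel. ?f x) = integral {-a..a} (L \<circ> ?f)"
      using integral_linear[OF integrable_continuous_real[OF cf] L] by simp
    moreover have "Complex 0 y + of_real t = Complex t y" for t by (simp add: complex_eq_iff)
    ultimately show ?thesis by (simp add: smear_def o_def Lr)
  qed
  hence "\<forall>\<^sub>F y in at_right 0. L (LINT x|lborel. u (Complex x y) * of_real (D 0 x))
      = smear (\<lambda>z. L (u z)) D a (Complex 0 y)"
    unfolding eventually_at_filter by (intro always_eventually) simp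
  ultimately show ?thesis by (rule Lim_transform_eventually)
qed

text \<open>\<open>Ln\<close> passes the growth bound on to the component; \<open>Lr\<close> takes
  real factors, the test function and \<open>1 / y\<close>, out of \<open>L\<close>.\<close>

lemma harmonic_component_uniqueness:
  fixes u :: "complex \<Rightarrow> complex" and L :: "complex \<Rightarrow> real"
  assumes harmonic: "harmonic_on upper_halfplane u"
    and temperate: "temperate_at_infinity u"
    and boundary: "boundary_limit_zero u"
    and distinct: "x1 \<noteq> x2"
    and ray1: "((\<lambda>y::real. u (Complex x1 y) / of_real y) \<longlongrightarrow> 0) at_top"
    and ray2: "((\<lambda>y::real. u (Complex x2 y) / of_real y) \<longlongrightarrow> 0) at_top"
    and L: "bounded_linear L" and Lr: "\<And>z r. L (z * of_real r) = L z * r" and Ln: "\<And>z. \<bar>L z\<bar> \<le> norm z"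
    and z: "z \<in> uhp"
  shows "L (u z) = 0"
proof -
  have uhp: "upper_halfplane = uhp" by (simp add: upper_halfplane_def)
  have cu: "continuous_on uhp u"
    using harmonic by (auto simp: harmonic_on_def numeral_2_eq_2 uhp)
  obtain h where h: "h holomorphic_on uhp" and Lh: "\<And>z. z \<in> uhp \<Longrightarrow> L (u z) = Im (h z)"
    using harmonic_on_imp_imaginary_part[OF harmonic _ L] convex_halfspace_Im_gt unfolding uhp by blast
  obtain R C M where R: "0 < R" and C: "0 \<le> C"
    and growth: "\<And>z. 0 < Im z \<Longrightarrow> R \<le> norm z \<Longrightarrow> norm (u z) * Im z ^ M \<le> C * norm z ^ (2 * M)"
    using temperate_natural_exponent[OF temperate] by blast
  have ray: "((\<lambda>y. Im (h (Complex x y)) / y) \<longlongrightarrow> 0) at_top"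
    if "((\<lambda>y::real. u (Complex x y) / of_real y) \<longlongrightarrow> 0) at_top" for x
  proof -
    have "((\<lambda>y::real. L (u (Complex x y) / of_real y)) \<longlongrightarrow> L 0) at_top"
      by (rule bounded_linear.tendsto[OF L that])
    hence "((\<lambda>y::real. L (u (Complex x y) / of_real y)) \<longlongrightarrow> 0) at_top"
      using linear_0[OF bounded_linear.linear[OF L]] by simp
    moreover have "L (u (Complex x y) / of_real y) = Im (h (Complex x y)) / y" if "0 < y" for y
      using Lr[of "u (Complex x y)" "1 / y"] Lh[of "Complex x y"] that by simp
    hence "\<forall>\<^sub>F y in at_top. L (u (Complex x y) / of_real y) = Im (h (Complex x y)) / y"
      by (intro eventually_mono[OF eventually_gt_at_top[of 0]])
    ultimately show ?thesis by (rule Lim_transform_eventually)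
  qed
  have "Im (h z) = 0"
  proof (rule holomorphic_imaginary_part_uniqueness[OF h _ R C _ distinct ray[OF ray1] ray[OF ray2] z])
    show "\<bar>Im (h z)\<bar> * Im z ^ M \<le> C * norm z ^ (2 * M)" if z: "0 < Im z" "R \<le> norm z" for z
    proof -
      have "\<bar>Im (h z)\<bar> \<le> norm (u z)" using Ln[of "u z"] Lh[of z] z by simp
      hence "\<bar>Im (h z)\<bar> * Im z ^ M \<le> norm (u z) * Im z ^ M" using z by (intro mult_right_mono) auto
      with growth[OF z] show ?thesis by linarith
    qed
    show "((\<lambda>y. smear (\<lambda>z. Im (h z)) D a (Complex 0 y)) \<longlongrightarrow> 0) (at_right 0)"
      if "smooth_tower D a" for D a
    proof (rule Lim_transform_eventually[OF boundary_limit_smear[OF boundary cu L Lr that]])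
      show "\<forall>\<^sub>F y in at_right 0. smear (\<lambda>z. L (u z)) D a (Complex 0 y) = smear (\<lambda>z. Im (h z)) D a (Complex 0 y)"
        unfolding eventually_at_filter smear_def
        by (intro always_eventually) (auto intro!: integral_cong simp: Lh)
    qed
  qed
  with Lh[OF z] show ?thesis by simp
qed

theorem theorem7p3:
  fixes u :: "complex \<Rightarrow> complex" and x1 x2 :: real
  assumes harmonic: "harmonic_on upper_halfplane u"
    and temperate: "temperate_at_infinity u"
    and boundary: "boundary_limit_zero u"
    and distinct: "x1 \<noteq> x2"
    and ray1: "((\<lambda>y::real. u (Complex x1 y) / of_real y) \<longlongrightarrow> 0) at_top"
    and ray2: "((\<lambda>y::real. u (Complex x2 y) / of_real y) \<longlongrightarrow> 0) at_top"
  shows "\<forall>z\<in>upper_halfplane. u z = 0"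
proof
  fix z assume "z \<in> upper_halfplane"
  hence z: "z \<in> uhp" by (simp add: upper_halfplane_def)
  have "Re (u z) = 0"
    by (rule harmonic_component_uniqueness[OF assms bounded_linear_Re _ abs_Re_le_cmod z]) simp
  moreover have "Im (u z) = 0"
    by (rule harmonic_component_uniqueness[OF assms bounded_linear_Im _ abs_Im_le_cmod z]) simp
  ultimately show "u z = 0" by (simp add: complex_eq_iff)
qed

end
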